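(* Let $G=(V,E)$ be a finite outerplanar graph and let $A_G$ be its adjacency poset. Then $\dim(A_G)\le 4$.
   Context: A graph is outerplanar if it can be embedded in the plane without edge crossings so that all vertices lie on the outer face. For a graph $G=(V,E)$, the adjacency poset $A_G$ is the poset of height at most $2$ whose ground set consists of a minimal element $x$ and a maximal element $\overline{x}$ for each vertex $x\in V$, with comparabilities exactly $x<\overline{y}$ and $y<\overline{x}$ for each edge $xy\in E$ (and no other strict comparabilities). A linear extension of a poset $P=(X,\le_P)$ is a total order $L$ on $X$ such that $x\le_P y$ implies $x\le_L y$. The dimension $\dim(P)$ is the smallest $n$ such that $P$ equals the intersection of $n$ linear extensions of $P$; equivalently, the smallest number of linear extensions such that for every ordered pair $(x,y)$ of incomparable elements, some extension in the family places $y$ below $x$. *)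

theory Defs
  imports "HOL-Analysis.Analysis"
begin

definition finite_simple_graph :: "'a set \<Rightarrow> 'a set set \<Rightarrow> bool" where
  "finite_simple_graph V E \<longleftrightarrow> finite V \<and> (\<forall>e\<in>E. e \<subseteq> V \<and> card e = 2)"

text \<open>
  The plane is \<^typ>\<open>complex\<close>, as in the library's Jordan curve theorem.  Edges are
  drawn as arbitrary arcs between their end vertices, not as straight segments.
\<close>

definition plane_embedding ::
  "'a set \<Rightarrow> 'a set set \<Rightarrow> ('a \<Rightarrow> complex) \<Rightarrow> ('a set \<Rightarrow> real \<Rightarrow> complex) \<Rightarrow> bool" where
  "plane_embedding V E p \<gamma> \<longleftrightarrow>
     inj_on p V \<and>
     (\<forall>e\<in>E. arc (\<gamma> e) \<and> {pathstart (\<gamma> e), pathfinish (\<gamma> e)} = p ` e \<and>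
             path_image (\<gamma> e) \<inter> p ` V = p ` e) \<and>
     (\<forall>e\<in>E. \<forall>f\<in>E. e \<noteq> f \<longrightarrow> path_image (\<gamma> e) \<inter> path_image (\<gamma> f) = p ` (e \<inter> f))"

definition drawing ::
  "'a set \<Rightarrow> 'a set set \<Rightarrow> ('a \<Rightarrow> complex) \<Rightarrow> ('a set \<Rightarrow> real \<Rightarrow> complex) \<Rightarrow> complex set" where
  "drawing V E p \<gamma> = p ` V \<union> (\<Union>e\<in>E. path_image (\<gamma> e))"

text \<open>
  The drawing of a finite graph is compact, so its \<^const>\<open>outside\<close> is exactly the unique
  unbounded face; a vertex lies on this face if it belongs to its boundary.
\<close>

definition outerplanar :: "'a set \<Rightarrow> 'a set set \<Rightarrow> bool" where
  "outerplanar V E \<longleftrightarrow>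
     (\<exists>p \<gamma>. plane_embedding V E p \<gamma> \<and> p ` V \<subseteq> frontier (outside (drawing V E p \<gamma>)))"

text \<open>
  In the adjacency poset, \<^term>\<open>Inl x\<close> is the minimal and \<^term>\<open>Inr x\<close> the
  maximal element belonging to the vertex \<open>x\<close>.
\<close>

definition adjacency_carrier :: "'a set \<Rightarrow> ('a + 'a) set" where
  "adjacency_carrier V = V <+> V"

definition adjacency_order :: "'a set \<Rightarrow> 'a set set \<Rightarrow> ('a + 'a) rel" where
  "adjacency_order V E = Id_on (adjacency_carrier V) \<union> {(Inl x, Inr y) | x y. {x, y} \<in> E}"

lemma partial_order_on_adjacency_order:
  assumes "finite_simple_graph V E"
  shows "partial_order_on (adjacency_carrier V) (adjacency_order V E)"
  using assms
  unfolding finite_simple_graph_def adjacency_order_def adjacency_carrier_def order_on_defs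
  by (auto simp: refl_on_def trans_def antisym_def)

definition linear_extension :: "'a set \<Rightarrow> 'a rel \<Rightarrow> 'a rel \<Rightarrow> bool" where
  "linear_extension X R L \<longleftrightarrow> linear_order_on X L \<and> R \<subseteq> L"

definition realizer :: "'a set \<Rightarrow> 'a rel \<Rightarrow> 'a rel set \<Rightarrow> bool" where
  "realizer X R \<L> \<longleftrightarrow>
     \<L> \<noteq> {} \<and> (\<forall>L\<in>\<L>. linear_extension X R L) \<and> \<Inter>\<L> = R"

text \<open>
  The value is \<^term>\<open>\<infinity>\<close> if there is no finite realizer.  Realizers are nonempty, so
  chains have dimension 1.
\<close>

definition poset_dim :: "'a set \<Rightarrow> 'a rel \<Rightarrow> enat" where
  "poset_dim X R = Inf {enat (card \<L>) | \<L>. finite \<L> \<and> realizer X R \<L>}"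

end

theory Submission
  imports Defs
begin

text \<open>
  No vertex of an outerplanar drawing is enclosed by a closed curve of the drawing.  Hence no two
  vertices are joined by three internally disjoint paths that all have inner vertices, and no
  cycle has crossing chords.  So each block is Hamiltonian with non-crossing chords, and gluing
  blocks places the vertices on a line such that no two edges cross when drawn above it.

  On such a line the graph is 3-colourable.  It suffices to find four orders of the vertices such
  that for all non-adjacent \<open>x\<close>, \<open>y\<close> (possibly equal) some order puts \<open>x\<close> above all neighbours of
  \<open>y\<close>.  One order is the preorder traversal of the forest in which the ancestors of \<open>x\<close> are the
  right ends of the edges covering \<open>x\<close>.  Each of the other three orders has one colour class on
  top, sorted by the spread of the neighbourhood, above the mirrored preorder of the remaining
  vertices.  The top parts settle pairs of equal colour and pairs where \<open>y\<close> is covered by an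
  edge at \<open>x\<close>; the preorders settle all others.
\<close>

subsection \<open>Non-crossing vertex orders\<close>

definition nbrs :: "'a set set \<Rightarrow> 'a \<Rightarrow> 'a set" where
  "nbrs E x = {w. {w, x} \<in> E}"

definition noncrossing :: "('a \<Rightarrow> int) \<Rightarrow> 'a set set \<Rightarrow> bool" where
  "noncrossing pos E \<longleftrightarrow>
     (\<forall>a b c d. {a, c} \<in> E \<longrightarrow> {b, d} \<in> E \<longrightarrow>
        pos a < pos b \<longrightarrow> pos b < pos c \<longrightarrow> \<not> pos c < pos d)"

lemma noncrossingD:
  "noncrossing pos E \<Longrightarrow> {a, c} \<in> E \<Longrightarrow> {b, d} \<in> E \<Longrightarrow>
     pos a < pos b \<Longrightarrow> pos b < pos c \<Longrightarrow> pos c < pos d \<Longrightarrow> False"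
  unfolding noncrossing_def by blast

lemma noncrossing_uminus:
  assumes "noncrossing pos E"
  shows "noncrossing (\<lambda>x. - pos x) E"
  unfolding noncrossing_def
proof (intro allI impI notI)
  fix a b c d
  assume "{a, c} \<in> E" "{b, d} \<in> E" "- pos a < - pos b" "- pos b < - pos c" "- pos c < - pos d"
  then show False
    using noncrossingD[OF assms, of d b c a] by (simp add: insert_commute)
qed

lemma edge_cases:
  assumes "finite_simple_graph V E" "{u, v} \<in> E"
  shows "u \<in> V" "v \<in> V" "u \<noteq> v"
  using assms unfolding finite_simple_graph_def by (force simp: card_insert_if)+

lemma nbrs_subset: "finite_simple_graph V E \<Longrightarrow> nbrs E x \<subseteq> V"
  unfolding nbrs_def using edge_cases(1) by fast

lemma finite_nbrs: "finite_simple_graph V E \<Longrightarrow> finite (nbrs E x)"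
  using nbrs_subset finite_subset unfolding finite_simple_graph_def by metis

lemma finite_simple_graph_induced:
  assumes "finite_simple_graph V E" "W \<subseteq> V"
  shows "finite_simple_graph W {e \<in> E. e \<subseteq> W}"
  using assms finite_subset unfolding finite_simple_graph_def by blast

lemma noncrossing_subset: "noncrossing pos E \<Longrightarrow> F \<subseteq> E \<Longrightarrow> noncrossing pos F"
  unfolding noncrossing_def by blast

subsection \<open>Colouring\<close>

text \<open>Among the edges that pass over some vertex take a shortest one, and let \<open>u\<close>
  lie under it. No edge at \<open>u\<close> can leave the interval below that edge, so edges at
  \<open>u\<close> are shorter and pass over nothing. If no edge passes over a vertex, every vertex
  will do.\<close>

lemma noncrossing_exists_local_vertex:
  assumes G: "finite_simple_graph V E" and nc: "noncrossing pos E"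
    and ne: "V \<noteq> {}"
  shows "\<exists>v\<in>V. \<forall>w\<in>nbrs E v. \<forall>u\<in>V.
           \<not> (pos v < pos u \<and> pos u < pos w) \<and> \<not> (pos w < pos u \<and> pos u < pos v)"
proof (cases "\<exists>a b u. {a, b} \<in> E \<and> u \<in> V \<and> pos a < pos u \<and> pos u < pos b")
  case False
  obtain v where "v \<in> V" using ne by blast
  moreover have "\<not> (pos v < pos u \<and> pos u < pos w) \<and> \<not> (pos w < pos u \<and> pos u < pos v)"
    if "w \<in> nbrs E v" "u \<in> V" for w u
  proof -
    have "{w, v} \<in> E" "{v, w} \<in> E" using that unfolding nbrs_def by (auto simp: insert_commute)
    then show ?thesis using False that(2) by blast
  qed
  ultimately show ?thesis by blast
next
  case True
  define S where "S = {n. \<exists>a b u. {a, b} \<in> E \<and> u \<in> V \<and> pos a < pos u \<and> pos u < pos b \<and> n = nat (pos b - pos a)}"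
  have "S \<noteq> {}" using True unfolding S_def by blast
  define m where "m = (LEAST n. n \<in> S)"
  have "m \<in> S" using \<open>S \<noteq> {}\<close> unfolding m_def by (metis LeastI ex_in_conv)
  then obtain a b u where ab: "{a, b} \<in> E" "u \<in> V" "pos a < pos u" "pos u < pos b" "m = nat (pos b - pos a)"
    unfolding S_def by blast
  have no: False if "{c, d} \<in> E" "t \<in> V" "pos c < pos t" "pos t < pos d" "pos d - pos c < pos b - pos a" for c d t
  proof -
    have "nat (pos d - pos c) \<in> S" using that unfolding S_def by blast
    then have "m \<le> nat (pos d - pos c)" unfolding m_def by (rule Least_le)
    then show False using that ab by linarith
  qed
  have "\<not> (pos u < pos t \<and> pos t < pos w) \<and> \<not> (pos w < pos t \<and> pos t < pos u)"
    if w: "w \<in> nbrs E u" and t: "t \<in> V" for w t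
  proof -
    have e: "{w, u} \<in> E" "{u, w} \<in> E" using w unfolding nbrs_def by (auto simp: insert_commute)
    have "pos a \<le> pos w" using noncrossingD[OF nc, of w u a b] e ab by force
    moreover have "pos w \<le> pos b" using noncrossingD[OF nc, of a b u w] e ab by force
    ultimately show ?thesis using no[OF e(1) t] no[OF e(2) t] ab by force
  qed
  then show ?thesis using ab(2) by blast
qed

text \<open>Two neighbours on the same side of a local vertex would put the nearer one strictly
  below the edge to the farther one.\<close>

lemma noncrossing_exists_degree_le_2:
  assumes G: "finite_simple_graph V E" and inj: "inj_on pos V" and nc: "noncrossing pos E"
    and ne: "V \<noteq> {}"
  shows "\<exists>v\<in>V. card (nbrs E v) \<le> 2"
proof -
  obtain v where v: "v \<in> V" and loc: "\<And>w u. w \<in> nbrs E v \<Longrightarrow> u \<in> V \<Longrightarrow>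
      \<not> (pos v < pos u \<and> pos u < pos w) \<and> \<not> (pos w < pos u \<and> pos u < pos v)"
    using noncrossing_exists_local_vertex[OF G nc ne] by blast
  let ?L = "{w \<in> nbrs E v. pos w < pos v}" and ?R = "{w \<in> nbrs E v. pos v < pos w}"
  have fin: "finite (nbrs E v)" using finite_nbrs[OF G] .
  have sub: "nbrs E v \<subseteq> V" using nbrs_subset[OF G] .
  have "w = w'" if "w \<in> ?L" "w' \<in> ?L" for w w'
  proof -
    have "w \<in> V" "w' \<in> V" using that sub by blast+
    moreover from this have "pos w = pos w'" using that loc[of w w'] loc[of w' w] by auto
    ultimately show ?thesis using inj_onD[OF inj] by blast
  qed
  then have L: "card ?L \<le> 1" using fin by (simp add: card_le_Suc0_iff_eq)
  have "w = w'" if "w \<in> ?R" "w' \<in> ?R" for w w'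
  proof -
    have "w \<in> V" "w' \<in> V" using that sub by blast+
    moreover from this have "pos w = pos w'" using that loc[of w w'] loc[of w' w] by auto
    ultimately show ?thesis using inj_onD[OF inj] by blast
  qed
  then have R: "card ?R \<le> 1" using fin by (simp add: card_le_Suc0_iff_eq)
  have "pos w \<noteq> pos v" if "w \<in> nbrs E v" for w
  proof -
    have "{w, v} \<in> E" using that unfolding nbrs_def by simp
    then show ?thesis using edge_cases[of V E w v] G v inj_onD[OF inj, of w v] by blast
  qed
  then have "nbrs E v = ?L \<union> ?R" by force
  then have "card (nbrs E v) \<le> card ?L + card ?R" by (metis card_Un_le)
  then show ?thesis using L R v by force
qed

text \<open>A vertex with at most two neighbours can be coloured last, and the order restricts to
  the rest of the graph.\<close>

lemma noncrossing_3_colourable: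
  assumes "finite_simple_graph V E" "inj_on pos V" "noncrossing pos E"
  shows "\<exists>col :: 'a \<Rightarrow> nat. (\<forall>v. col v < 3) \<and> (\<forall>u v. {u, v} \<in> E \<longrightarrow> col u \<noteq> col v)"
  using assms
proof (induction "card V" arbitrary: V E)
  case 0
  then have "V = {}" unfolding finite_simple_graph_def by simp
  then have "\<And>u v. {u, v} \<notin> E" using edge_cases[OF 0(2)] by blast
  then show ?case by (intro exI[of _ "\<lambda>_. 0"]) simp
next
  case (Suc n)
  then have "V \<noteq> {}" by force
  then obtain v where v: "v \<in> V" "card (nbrs E v) \<le> 2"
    using noncrossing_exists_degree_le_2 Suc.prems by blast
  let ?F = "{e \<in> E. e \<subseteq> V - {v}}"
  have "n = card (V - {v})" using Suc.hyps(2) v(1) by simp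
  moreover have "finite_simple_graph (V - {v}) ?F"
    using finite_simple_graph_induced[OF Suc.prems(1)] by blast
  moreover have "inj_on pos (V - {v})" using Suc.prems(2) by (rule inj_on_diff)
  moreover have "noncrossing pos ?F" by (rule noncrossing_subset[OF Suc.prems(3)]) simp
  ultimately have "\<exists>col :: 'a \<Rightarrow> nat. (\<forall>v. col v < 3) \<and> (\<forall>u v. {u, v} \<in> ?F \<longrightarrow> col u \<noteq> col v)"
    by (rule Suc.hyps(1))
  then obtain col :: "'a \<Rightarrow> nat" where col: "\<And>v. col v < 3" "\<And>u w. {u, w} \<in> ?F \<Longrightarrow> col u \<noteq> col w"
    by blast
  have "card (col ` nbrs E v) < card {..<3::nat}"
    using v(2) card_image_le[OF finite_nbrs[OF Suc.prems(1)], of col v] by simp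
  then have "\<not> {..<3::nat} \<subseteq> col ` nbrs E v"
    using card_mono[OF finite_imageI[OF finite_nbrs[OF Suc.prems(1)]]] by (metis not_less)
  then obtain k where k: "k < 3" "k \<notin> col ` nbrs E v" by blast
  have "(col(v := k)) u \<noteq> (col(v := k)) w" if e: "{u, w} \<in> E" for u w
  proof -
    have "{w, u} \<in> E" using e by (simp add: insert_commute)
    then show ?thesis
      using e edge_cases[OF Suc.prems(1) e] k(2) col(2)[of u w] unfolding nbrs_def by auto
  qed
  moreover have "(col(v := k)) u < 3" for u using k(1) col(1) by simp
  ultimately show ?case by blast
qed

subsection \<open>Four orders\<close>

text \<open>
  The descendants of \<open>x\<close> in the forest fill the interval from the left end of \<open>x\<close> to \<open>x\<close>, so
  the preorder sorts by left ends and, for equal left ends, from right to left.  If \<open>K\<close> exceeds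
  all distances, then \<open>preorder_key\<close> encodes this lexicographic order in one number.
\<close>

definition left_end :: "'a set set \<Rightarrow> ('a \<Rightarrow> int) \<Rightarrow> 'a \<Rightarrow> int" where
  "left_end E pos x = Min (insert (pos x - 1) (pos ` nbrs E x))"

definition preorder_key :: "'a set set \<Rightarrow> int \<Rightarrow> ('a \<Rightarrow> int) \<Rightarrow> 'a \<Rightarrow> int" where
  "preorder_key E K pos x = K * left_end E pos x - pos x"

text \<open>The spread is that of the closed neighbourhood: including \<open>x\<close> makes the set
  under \<open>Max\<close> nonempty, and absolute values make it invariant under mirroring.\<close>

definition nbr_span :: "'a set set \<Rightarrow> ('a \<Rightarrow> int) \<Rightarrow> 'a \<Rightarrow> int" where
  "nbr_span E pos x = Max ((\<lambda>(u, v). \<bar>pos u - pos v\<bar>) ` (insert x (nbrs E x) \<times> insert x (nbrs E x)))"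

text \<open>This settles the pairs where \<open>y\<close> precedes \<open>x\<close> and no edge at
  \<open>x\<close> passes over \<open>y\<close>. A neighbour \<open>w\<close> of \<open>y\<close>
  before \<open>x\<close> has a strictly smaller left end; one beyond \<open>x\<close> has a left
  end at most that of \<open>x\<close>, and ties are broken from right to left.\<close>

lemma preorder_key_less:
  assumes G: "finite_simple_graph V E" and inj: "inj_on pos V" and nc: "noncrossing pos E"
    and K: "\<And>u v. u \<in> V \<Longrightarrow> v \<in> V \<Longrightarrow> pos u - pos v < K"
    and x: "x \<in> V" and y: "y \<in> V" and nadj: "{x, y} \<notin> E" and less: "pos y < pos x"
    and uncov: "\<And>a. {a, x} \<in> E \<Longrightarrow> pos y \<le> pos a"
    and w: "{w, y} \<in> E"
  shows "preorder_key E K pos w < preorder_key E K pos x"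
proof -
  have fin: "finite (insert (pos u - 1) (pos ` nbrs E u))" for u
    using finite_nbrs[OF G] by simp
  have wV: "w \<in> V" using edge_cases[OF G w] by blast
  have wy: "{y, w} \<in> E" using w by (simp add: insert_commute)
  \<comment> \<open>The default \<open>pos w - 1\<close> in \<open>left_end\<close> gives this even
    when \<open>w\<close> has no neighbour to its left.\<close>
  have lw1: "left_end E pos w \<le> pos w - 1" unfolding left_end_def using fin[of w] by (intro Min_le) auto
  have lw2: "left_end E pos w \<le> pos y" unfolding left_end_def
    using fin wy by (intro Min_le) (auto simp: nbrs_def)
  have lx: "left_end E pos x \<in> insert (pos x - 1) (pos ` nbrs E x)"
    unfolding left_end_def using fin by (intro Min_in) auto
  then have lx1: "pos y \<le> left_end E pos x" using less uncov unfolding nbrs_def by auto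
  have "pos w \<noteq> pos x" using w nadj inj x wV unfolding inj_on_def by blast
  then consider "pos w < pos x" | "pos x < pos w" by linarith
  then show ?thesis
  proof cases
    case 1
    have "left_end E pos w < left_end E pos x"
    proof (cases "pos w \<le> pos y")
      case True then show ?thesis using lw1 lx1 by linarith
    next
      case False
      \<comment> \<open>A neighbour \<open>a\<close> of \<open>x\<close> strictly between
        \<open>y\<close> and \<open>w\<close> would make \<open>{a, x}\<close> cross
        \<open>{y, w}\<close>.\<close>
      have "pos w \<le> pos a" if a: "{a, x} \<in> E" for a
      proof (rule ccontr)
        assume "\<not> pos w \<le> pos a"
        moreover have "pos y \<noteq> pos a"
          using a nadj inj y edge_cases[OF G a] unfolding inj_on_def by (metis insert_commute)
        ultimately show False
          using noncrossingD[OF nc wy a] uncov[OF a] 1 by force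
      qed
      then have "pos w \<le> left_end E pos x" using lx 1 unfolding nbrs_def by auto
      then show ?thesis using lw1 by linarith
    qed
    then have "1 \<le> left_end E pos x - left_end E pos w" by simp
    moreover have "0 < K" using K[OF x x] by simp
    ultimately have "K * 1 \<le> K * (left_end E pos x - left_end E pos w)" by (intro mult_left_mono) auto
    then show ?thesis using K[OF x wV] unfolding preorder_key_def by (simp add: right_diff_distrib)
  next
    case 2
    moreover have "0 < K" using K[OF x x] by simp
    ultimately show ?thesis unfolding preorder_key_def
      using mult_left_mono[of "left_end E pos w" "left_end E pos x" K] lw2 lx1 by linarith
  qed
qed

text \<open>The edge \<open>{a, x}\<close> passes over \<open>y\<close>. This traps \<open>w\<close>
  strictly between \<open>a\<close> and \<open>x\<close>, and the neighbours of \<open>w\<close>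
  before \<open>x\<close> and not before \<open>a\<close>. So the spread of \<open>w\<close> is less
  than the length of \<open>{a, x}\<close>.\<close>

lemma nbr_span_less:
  assumes G: "finite_simple_graph V E" and inj: "inj_on pos V" and nc: "noncrossing pos E"
    and x: "x \<in> V" and nadj: "{x, y} \<notin> E"
    and a: "{a, x} \<in> E" "pos a < pos y" "pos y < pos x"
    and w: "{w, y} \<in> E" "\<not> {w, x} \<in> E" "w \<noteq> a"
  shows "nbr_span E pos w < nbr_span E pos x"
proof -
  have fin: "finite (insert u (nbrs E u) \<times> insert u (nbrs E u))" for u
    using finite_nbrs[OF G] by simp
  have wV: "w \<in> V" using edge_cases[OF G w(1)] by blast
  have aV: "a \<in> V" using edge_cases[OF G a(1)] by blast
  have wy: "{y, w} \<in> E" using w by (simp add: insert_commute)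
  have "w \<noteq> x" using w(1) nadj by blast
  then have neq: "pos w \<noteq> pos x" "pos w \<noteq> pos a"
    using w(3) inj x wV aV unfolding inj_on_def by blast+
  have w1: "pos a < pos w"
    using noncrossingD[OF nc w(1) a(1)] a neq by force
  have w2: "pos w < pos x"
    using noncrossingD[OF nc a(1) wy] a neq by force
  have rng: "pos a \<le> pos u \<and> pos u < pos x" if u: "u \<in> insert w (nbrs E w)" for u
  proof (cases "u = w")
    case True then show ?thesis using w1 w2 by simp
  next
    case False
    then have e: "{u, w} \<in> E" "{w, u} \<in> E" using u unfolding nbrs_def by (auto simp: insert_commute)
    have "u \<noteq> x" using e(2) w(2) by blast
    then have "pos u \<noteq> pos x" using inj x edge_cases[OF G e(1)] unfolding inj_on_def by blast
    then show ?thesis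
      using noncrossingD[OF nc e(1) a(1)] noncrossingD[OF nc a(1) e(2)] w1 w2 by force
  qed
  have "nbr_span E pos w \<in> (\<lambda>(u, v). \<bar>pos u - pos v\<bar>) ` (insert w (nbrs E w) \<times> insert w (nbrs E w))"
    unfolding nbr_span_def using fin by (intro Max_in) auto
  then obtain u v where uv: "u \<in> insert w (nbrs E w)" "v \<in> insert w (nbrs E w)"
    "nbr_span E pos w = \<bar>pos u - pos v\<bar>" by (elim imageE) (metis case_prod_conv mem_Sigma_iff prod.collapse)
  then have "nbr_span E pos w < \<bar>pos a - pos x\<bar>" using rng[OF uv(1)] rng[OF uv(2)] by linarith
  also have "\<bar>pos a - pos x\<bar> \<le> nbr_span E pos x"
    unfolding nbr_span_def
    by (intro Max_ge) (use fin a(1) in \<open>auto simp: nbrs_def image_iff intro!: bexI[of _ "(a, x)"]\<close>)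
  finally show ?thesis .
qed

lemma nbr_span_uminus: "nbr_span E (\<lambda>x. - pos x) = nbr_span E pos"
  unfolding nbr_span_def by (auto simp: fun_eq_iff abs_minus_commute)

lemma noncrossing_four_keys:
  assumes G: "finite_simple_graph V E" and inj: "inj_on pos V" and nc: "noncrossing pos E"
  shows "\<exists>f :: nat \<Rightarrow> 'a \<Rightarrow> int. \<forall>x\<in>V. \<forall>y\<in>V. {x, y} \<notin> E \<longrightarrow>
           (\<exists>i<4. \<forall>w. {w, y} \<in> E \<longrightarrow> f i w < f i x)"
proof -
  obtain col :: "'a \<Rightarrow> nat" where col: "\<And>v. col v < 3" "\<And>u v. {u, v} \<in> E \<Longrightarrow> col u \<noteq> col v"
    using noncrossing_3_colourable[OF assms] by blast
  have finV: "finite V" using G unfolding finite_simple_graph_def by blast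
  define K where "K = 1 + Max (insert 0 ((\<lambda>(u, v). \<bar>pos u - pos v\<bar>) ` (V \<times> V)))"
  have K': "\<bar>pos u - pos v\<bar> < K" if "u \<in> V" "v \<in> V" for u v
  proof -
    have "\<bar>pos u - pos v\<bar> \<le> Max (insert 0 ((\<lambda>(u, v). \<bar>pos u - pos v\<bar>) ` (V \<times> V)))"
      by (rule Max_ge) (use that finV in auto)
    then show ?thesis unfolding K_def by simp
  qed
  have K: "pos u - pos v < K" if "u \<in> V" "v \<in> V" for u v using K'[OF that] by linarith
  have Km: "- pos u - - pos v < K" if "u \<in> V" "v \<in> V" for u v using K'[OF that] by linarith
  let ?neg = "\<lambda>x. - pos x"
  have injm: "inj_on ?neg V" using inj unfolding inj_on_def by simp
  note ncm = noncrossing_uminus[OF nc]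
  define B where "B = 1 + Max (insert 0 (preorder_key E K ?neg ` V))"
  have B: "preorder_key E K ?neg v < B" if "v \<in> V" for v
  proof -
    have "preorder_key E K ?neg v \<le> Max (insert 0 (preorder_key E K ?neg ` V))"
      by (rule Max_ge) (use that finV in auto)
    then show ?thesis unfolding B_def by simp
  qed
  have span_nonneg: "0 \<le> nbr_span E pos v" for v
    unfolding nbr_span_def
    by (rule Max_ge) (use finite_nbrs[OF G] in \<open>auto simp: image_iff intro!: bexI[of _ "(v, v)"]\<close>)
  \<comment> \<open>Keys 0 to 2 each lift one colour class above all other vertices, since
    \<open>B\<close> exceeds every mirrored preorder key; key 3 is the plain preorder.\<close>
  define f where "f i x = (if i = 3 then preorder_key E K pos x
      else if col x = i then B + nbr_span E pos x else preorder_key E K ?neg x)" for i :: nat and x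
  have f3: "f 3 x = preorder_key E K pos x" for x unfolding f_def by simp
  have ftop: "f (col x) x = B + nbr_span E pos x" for x using col(1)[of x] unfolding f_def by simp
  have fbot: "f (col y) x = preorder_key E K ?neg x" if "col x \<noteq> col y" for x y
    using col(1)[of y] that unfolding f_def by simp
  have "\<exists>i<4. \<forall>w. {w, y} \<in> E \<longrightarrow> f i w < f i x" if x: "x \<in> V" and y: "y \<in> V" and nadj: "{x, y} \<notin> E" for x y
  proof -
    have small: "f (col x) w < f (col x) x" if "w \<in> V" "col w \<noteq> col x" for w
      using fbot[OF that(2)] ftop[of x] B[OF that(1)] span_nonneg[of x] by linarith
    have colx: "col x < 4" "col y < 4" using col(1)[of x] col(1)[of y] by simp_all
    have top: ?thesis
      if *: "\<And>w. {w, y} \<in> E \<Longrightarrow> col w = col x \<Longrightarrow> nbr_span E pos w < nbr_span E pos x"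
    proof (intro exI[of _ "col x"] conjI allI impI)
      fix w assume w: "{w, y} \<in> E"
      show "f (col x) w < f (col x) x"
      proof (cases "col w = col x")
        case True then show ?thesis using *[OF w True] ftop[of w] ftop[of x] by simp
      next
        case False then show ?thesis using small edge_cases[OF G w] by blast
      qed
    qed (rule colx)
    \<comment> \<open>These are the side conditions of \<open>nbr_span_less\<close>; only neighbours
      of \<open>y\<close> with the colour of \<open>x\<close> compete with \<open>x\<close> in the
      lifted class.\<close>
    have colne: "\<not> {w, x} \<in> E \<and> w \<noteq> a" if "col w = col x" "{a, x} \<in> E" for w a
      using that col(2) by metis
    show ?thesis
    proof (cases "col x = col y")
      case True
      \<comment> \<open>No neighbour of \<open>y\<close> has the colour of \<open>y\<close>, which
        is that of \<open>x\<close>, so the condition in \<open>top\<close> is vacuous.\<close>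
      then show ?thesis using top col(2) by metis
    next
      case False
      then have "x \<noteq> y" by blast
      then have "pos x \<noteq> pos y" using inj x y unfolding inj_on_def by blast
      then consider "pos y < pos x" | "pos x < pos y" by linarith
      then show ?thesis
      proof cases
        case 1
        show ?thesis
        proof (cases "\<exists>a. {a, x} \<in> E \<and> pos a < pos y")
          case True
          then obtain a where a: "{a, x} \<in> E" "pos a < pos y" by blast
          show ?thesis
            by (rule top, rule nbr_span_less[OF G inj nc x nadj a 1]) (use colne[OF _ a(1)] in auto)
        next
          case False
          then have "f 3 w < f 3 x" if "{w, y} \<in> E" for w
            using preorder_key_less[OF G inj nc K x y nadj 1 _ that] unfolding f3 by force
          then show ?thesis by (intro exI[of _ 3]) simp
        qed
      next
        case 2
        then have 2: "- pos y < - pos x" by simp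
        show ?thesis
        proof (cases "\<exists>a. {a, x} \<in> E \<and> - pos a < - pos y")
          case True
          then obtain a where a: "{a, x} \<in> E" "- pos a < - pos y" by blast
          show ?thesis
            by (rule top, rule nbr_span_less[OF G injm ncm x nadj a 2, unfolded nbr_span_uminus])
              (use colne[OF _ a(1)] in auto)
        next
          case no: False
          \<comment> \<open>Neither \<open>x\<close> nor any neighbour of \<open>y\<close> has the
            colour of \<open>y\<close>, so in the order lifting that colour both are still sorted by
            the mirrored preorder.\<close>
          have "f (col y) w < f (col y) x" if w: "{w, y} \<in> E" for w
            using preorder_key_less[OF G injm ncm Km x y nadj 2 _ w] no
              fbot[OF False] fbot[of w y] col(2)[OF w] by force
          then show ?thesis using colx(2) by blast
        qed
      qed
    qed
  qed
  then show ?thesis by blast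
qed

subsection \<open>Linear extensions\<close>

text \<open>
  Reversing pairs of two minimal or of two maximal elements needs no extra argument once every
  vertex has a private neighbour, so the four orders are taken for the graph with a leaf
  attached to each vertex.
\<close>

definition pendant_edges :: "'a set \<Rightarrow> 'a set set \<Rightarrow> ('a \<times> bool) set set" where
  "pendant_edges V E =
     {{(u, False), (v, False)} | u v. {u, v} \<in> E} \<union> {{(v, False), (v, True)} | v. v \<in> V}"

lemma pendant_edges_iff:
  "{(u, False), (v, False)} \<in> pendant_edges V E \<longleftrightarrow> {u, v} \<in> E"
  "{(u, False), (v, True)} \<in> pendant_edges V E \<longleftrightarrow> u = v \<and> v \<in> V"
  "{(u, True), (v, False)} \<in> pendant_edges V E \<longleftrightarrow> u = v \<and> v \<in> V"
  "{(u, True), (v, True)} \<notin> pendant_edges V E"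
  unfolding pendant_edges_def by (auto simp: doubleton_eq_iff insert_commute)

lemma finite_simple_graph_pendant:
  assumes "finite_simple_graph V E"
  shows "finite_simple_graph (V \<times> UNIV) (pendant_edges V E)"
  unfolding finite_simple_graph_def
proof (intro conjI ballI)
  show "finite (V \<times> (UNIV :: bool set))" using assms unfolding finite_simple_graph_def by simp
next
  fix e assume "e \<in> pendant_edges V E"
  then consider u v where "e = {(u, False), (v, False)}" "{u, v} \<in> E"
    | v where "e = {(v, False), (v, True)}" "v \<in> V"
    unfolding pendant_edges_def by blast
  then have "e \<subseteq> V \<times> UNIV \<and> card e = 2"
  proof cases
    case (1 u v) then show ?thesis using edge_cases[OF assms 1(2)] by simp
  next
    case (2 v) then show ?thesis by simp
  qed
  then show "e \<subseteq> V \<times> UNIV" "card e = 2" by blast+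
qed

text \<open>Doubling the positions frees the slot just after each vertex for its leaf.\<close>

definition pendant_pos :: "('a \<Rightarrow> int) \<Rightarrow> 'a \<times> bool \<Rightarrow> int" where
  "pendant_pos pos = (\<lambda>(v, b). 2 * pos v + (if b then 1 else 0))"

lemma inj_on_pendant_pos:
  assumes "inj_on pos V"
  shows "inj_on (pendant_pos pos) (V \<times> UNIV)"
proof (rule inj_onI)
  fix s t :: "'a \<times> bool"
  assume *: "s \<in> V \<times> UNIV" "t \<in> V \<times> UNIV" "pendant_pos pos s = pendant_pos pos t"
  obtain u b v c where st: "s = (u, b)" "t = (v, c)" by (cases s, cases t)
  have "2 * pos u + (if b then 1 else 0) = 2 * pos v + (if c then 1 else 0)"
    using * st unfolding pendant_pos_def by simp
  then have "pos u = pos v \<and> b = c" by (cases b; cases c; simp; presburger)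
  then show "s = t" using st * inj_onD[OF assms, of u v] by simp
qed

text \<open>A pendant edge joins consecutive integers, so nothing lies strictly below it and it
  takes part in no crossing.\<close>

lemma noncrossing_pendant:
  assumes "noncrossing pos E"
  shows "noncrossing (pendant_pos pos) (pendant_edges V E)"
  unfolding noncrossing_def
proof (intro allI impI notI)
  fix a b c d :: "'a \<times> bool"
  assume e: "{a, c} \<in> pendant_edges V E" "{b, d} \<in> pendant_edges V E"
    and lt: "pendant_pos pos a < pendant_pos pos b" "pendant_pos pos b < pendant_pos pos c"
      "pendant_pos pos c < pendant_pos pos d"
  obtain a' ba b' bb c' bc d' bd where
    *: "a = (a', ba)" "b = (b', bb)" "c = (c', bc)" "d = (d', bd)"
    by (cases a, cases b, cases c, cases d)
  have wide: "\<not> ba \<and> \<not> bc \<and> {a', c'} \<in> E"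
  proof -
    have "a' \<noteq> c'" using lt * unfolding pendant_pos_def by (auto split: if_splits)
    then show ?thesis using e(1) * by (cases ba; cases bc) (auto simp: pendant_edges_iff)
  qed
  have wide': "\<not> bb \<and> \<not> bd \<and> {b', d'} \<in> E"
  proof -
    have "b' \<noteq> d'" using lt * unfolding pendant_pos_def by (auto split: if_splits)
    then show ?thesis using e(2) * by (cases bb; cases bd) (auto simp: pendant_edges_iff)
  qed
  show False
    using noncrossingD[OF assms, of a' c' b' d'] wide wide' lt *
    unfolding pendant_pos_def by auto
qed

definition key_order :: "'b set \<Rightarrow> ('b \<Rightarrow> int) \<Rightarrow> ('b \<Rightarrow> nat) \<Rightarrow> 'b rel" where
  "key_order X k idx =
     {(s, t). s \<in> X \<and> t \<in> X \<and> (k s < k t \<or> k s = k t \<and> idx s \<le> idx t)}"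

lemma linear_order_on_key_order:
  assumes "inj_on idx X"
  shows "linear_order_on X (key_order X k idx)"
  using assms unfolding key_order_def order_on_defs
  by (auto simp: refl_on_def trans_def antisym_def total_on_def inj_on_def)

lemma key_orderD: "(s, t) \<in> key_order X k idx \<Longrightarrow> k s \<le> k t"
  unfolding key_order_def by auto

text \<open>Each of the four keys orders the minimal elements; every maximal element is inserted
  directly above its highest neighbour in the graph with leaves.\<close>

lemma noncrossing_poset_dim_le_4:
  fixes V :: "'a set"
  assumes G: "finite_simple_graph V E" and inj: "inj_on pos V" and nc: "noncrossing pos E"
  shows "poset_dim (adjacency_carrier V) (adjacency_order V E) \<le> 4"
proof -
  let ?X = "adjacency_carrier V" and ?R = "adjacency_order V E" and ?F = "pendant_edges V E"
  have finV: "finite V" using G unfolding finite_simple_graph_def by blast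
  note G' = finite_simple_graph_pendant[OF G]
  obtain f :: "nat \<Rightarrow> 'a \<times> bool \<Rightarrow> int" where
    f: "\<And>x y. x \<in> V \<times> UNIV \<Longrightarrow> y \<in> V \<times> UNIV \<Longrightarrow> {x, y} \<notin> ?F \<Longrightarrow>
           \<exists>i<4. \<forall>w. {w, y} \<in> ?F \<longrightarrow> f i w < f i x"
    using noncrossing_four_keys[OF G' inj_on_pendant_pos[OF inj] noncrossing_pendant[OF nc]]
    by meson
  define top where "top i y = Max (f i ` nbrs ?F (y, False))" for i y
  have top_ge: "f i w \<le> top i y" if "{w, (y, False)} \<in> ?F" for i w y
    unfolding top_def
    by (rule Max_ge) (use that finite_nbrs[OF G'] in \<open>auto simp: nbrs_def\<close>)
  \<comment> \<open>The leaf of \<open>y\<close> ensures that the maximum ranges over a nonempty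
    set.\<close>
  have top_less: "top i y < b" if "y \<in> V" "\<And>w. {w, (y, False)} \<in> ?F \<Longrightarrow> f i w < b" for i y b
  proof -
    have "(y, True) \<in> nbrs ?F (y, False)" using that(1) unfolding nbrs_def by (simp add: pendant_edges_iff)
    then have "top i y \<in> f i ` nbrs ?F (y, False)"
      unfolding top_def using finite_nbrs[OF G'] by (intro Max_in) auto
    then show ?thesis using that(2) unfolding nbrs_def by auto
  qed
  \<comment> \<open>Doubling and the odd offset put \<open>Inr y\<close> strictly above all its
    neighbours and strictly below every \<open>Inl x\<close> whose value exceeds
    \<open>top i y\<close>.\<close>
  define key where "key i = case_sum (\<lambda>x. 2 * f i (x, False)) (\<lambda>y. 2 * top i y + 1)" for i
  have key: "key i (Inl x) = 2 * f i (x, False)" "key i (Inr y) = 2 * top i y + 1" for i x y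
    unfolding key_def by simp_all
  have "finite ?X" using finV unfolding adjacency_carrier_def by simp
  then obtain idx :: "'a + 'a \<Rightarrow> nat" where idx: "inj_on idx ?X"
    using finite_imp_inj_to_nat_seg by metis
  define L where "L i = key_order ?X (key i) idx" for i
  have ext: "linear_extension ?X ?R (L i)" for i
    unfolding linear_extension_def
  proof
    show "linear_order_on ?X (L i)" unfolding L_def by (rule linear_order_on_key_order[OF idx])
    show "?R \<subseteq> L i"
    proof
      fix q assume "q \<in> ?R"
      then consider s where "s \<in> ?X" "q = (s, s)" | x y where "q = (Inl x, Inr y)" "{x, y} \<in> E"
        unfolding adjacency_order_def by blast
      then show "q \<in> L i"
      proof cases
        case 1 then show ?thesis unfolding L_def key_order_def by simp
      next
        case (2 x y)
        then have "f i (x, False) \<le> top i y" by (intro top_ge) (simp add: pendant_edges_iff)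
        then show ?thesis using 2 edge_cases[OF G 2(2)]
          unfolding L_def key_order_def adjacency_carrier_def by (auto simp: key)
      qed
    qed
  qed
  have sep: "\<exists>i<4. key i t < key i s" if s: "s \<in> ?X" and t: "t \<in> ?X" and nR: "(s, t) \<notin> ?R" for s t
  proof -
    have st: "s \<noteq> t" using nR s unfolding adjacency_order_def by blast
    consider (ll) x y where "s = Inl x" "t = Inl y" "x \<in> V" "y \<in> V"
      | (lr) x y where "s = Inl x" "t = Inr y" "x \<in> V" "y \<in> V"
      | (rl) x y where "s = Inr x" "t = Inl y" "x \<in> V" "y \<in> V"
      | (rr) x y where "s = Inr x" "t = Inr y" "x \<in> V" "y \<in> V"
      using s t unfolding adjacency_carrier_def by (elim PlusE) blast+
    then show ?thesis
    proof cases
      case ll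
      \<comment> \<open>The leaf of \<open>y\<close> has \<open>y\<close> as its only neighbour, so
        exceeding the neighbours of the leaf means exceeding \<open>y\<close>.\<close>
      have "{(x, False), (y, True)} \<notin> ?F" using st ll by (simp add: pendant_edges_iff)
      then obtain i where i: "i < 4" "\<And>w. {w, (y, True)} \<in> ?F \<Longrightarrow> f i w < f i (x, False)"
        using f[of "(x, False)" "(y, True)"] ll by auto
      then have "f i (y, False) < f i (x, False)" using ll by (simp add: pendant_edges_iff)
      then show ?thesis using i(1) ll by (auto simp: key)
    next
      case lr
      have "{x, y} \<notin> E" using nR lr unfolding adjacency_order_def by blast
      then have "{(x, False), (y, False)} \<notin> ?F" by (simp add: pendant_edges_iff)
      then obtain i where i: "i < 4" "\<And>w. {w, (y, False)} \<in> ?F \<Longrightarrow> f i w < f i (x, False)"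
        using f[of "(x, False)" "(y, False)"] lr by auto
      then have "top i y < f i (x, False)" using top_less lr by blast
      then show ?thesis using i(1) lr by (auto simp: key)
    next
      case rl
      \<comment> \<open>The leaf of \<open>x\<close> is a neighbour of \<open>x\<close>, so its
        value bounds \<open>top i x\<close> from below. Leaves are never adjacent, so
        \<open>x = y\<close> is covered too.\<close>
      have "{(x, True), (y, True)} \<notin> ?F" by (simp add: pendant_edges_iff)
      then obtain i where i: "i < 4" "\<And>w. {w, (y, True)} \<in> ?F \<Longrightarrow> f i w < f i (x, True)"
        using f[of "(x, True)" "(y, True)"] rl by auto
      then have "f i (y, False) < f i (x, True)" using rl by (simp add: pendant_edges_iff)
      moreover have "f i (x, True) \<le> top i x" using rl by (intro top_ge) (simp add: pendant_edges_iff)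
      ultimately show ?thesis using i(1) rl by (auto simp: key)
    next
      case rr
      have "{(x, True), (y, False)} \<notin> ?F" using st rr by (simp add: pendant_edges_iff)
      then obtain i where i: "i < 4" "\<And>w. {w, (y, False)} \<in> ?F \<Longrightarrow> f i w < f i (x, True)"
        using f[of "(x, True)" "(y, False)"] rr by auto
      then have "top i y < f i (x, True)" using top_less rr by blast
      moreover have "f i (x, True) \<le> top i x" using rr by (intro top_ge) (simp add: pendant_edges_iff)
      ultimately show ?thesis using i(1) rr by (auto simp: key)
    qed
  qed
  have "\<Inter> (L ` {..<4}) = ?R"
  proof
    show "?R \<subseteq> \<Inter> (L ` {..<4})" using ext unfolding linear_extension_def by blast
    show "\<Inter> (L ` {..<4}) \<subseteq> ?R"
    proof
      fix q assume q: "q \<in> \<Inter> (L ` {..<4})"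
      obtain s t where st: "q = (s, t)" by (cases q)
      have le: "(s, t) \<in> key_order ?X (key i) idx" if "i < 4" for i
        using q that unfolding st L_def by blast
      have "s \<in> ?X" "t \<in> ?X" using le[of 0] unfolding key_order_def by simp_all
      then show "q \<in> ?R" using sep[of s t] key_orderD[OF le] unfolding st by force
    qed
  qed
  then have "realizer ?X ?R (L ` {..<4})"
    unfolding realizer_def using ext lessThan_empty_iff[of "4::nat"] by simp
  then have "enat (card (L ` {..<4})) \<in> {enat (card \<L>) | \<L>. finite \<L> \<and> realizer ?X ?R \<L>}"
    by blast
  then have "poset_dim ?X ?R \<le> enat (card (L ` {..<4}))"
    unfolding poset_dim_def by (rule Inf_lower)
  also have "\<dots> \<le> enat 4" using card_image_le[of "{..<4::nat}" L] by simp
  finally show ?thesis by (simp add: numeral_eq_enat)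
qed

subsection \<open>From forbidden configurations to a vertex order\<close>

fun ledges :: "'a list \<Rightarrow> 'a set set" where
  "ledges (x # y # zs) = insert {x, y} (ledges (y # zs))"
| "ledges [x] = {}"
| "ledges [] = {}"

lemma ledges_append: "ledges (xs @ y # zs) = ledges (xs @ [y]) \<union> ledges (y # zs)"
  by (induction xs rule: ledges.induct) auto

lemma ledges_rev: "ledges (rev xs) = ledges xs"
proof (induction xs rule: ledges.induct)
  case (1 x y zs)
  have "ledges (rev (x # y # zs)) = ledges (rev zs @ y # [x])" by simp
  also have "\<dots> = ledges (rev (y # zs)) \<union> {{y, x}}" by (subst ledges_append) simp
  finally show ?case using 1 by (simp add: insert_commute)
qed auto

lemma ledges_subset: "e \<in> ledges xs \<Longrightarrow> e \<subseteq> set xs"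
  by (induction xs rule: ledges.induct) auto

lemma ledges_snoc: "xs \<noteq> [] \<Longrightarrow> ledges (xs @ [y]) = insert {last xs, y} (ledges xs)"
  by (induction xs rule: ledges.induct) auto

text \<open>The excluded triples of paths are the subdivisions of \<open>K_{2,3}\<close>: nonempty
  \<open>P\<close>, \<open>Q\<close>, \<open>R\<close> give every path an inner vertex.\<close>

definition no_theta :: "'a set set \<Rightarrow> bool" where
  "no_theta E \<longleftrightarrow> (\<forall>a b P Q R. P \<noteq> [] \<longrightarrow> Q \<noteq> [] \<longrightarrow> R \<noteq> [] \<longrightarrow> distinct (a # b # P @ Q @ R) \<longrightarrow>
     \<not> ledges (a # P @ [b]) \<union> ledges (a # Q @ [b]) \<union> ledges (a # R @ [b]) \<subseteq> E)"

text \<open>The vertices \<open>a\<close>, \<open>b\<close>, \<open>c\<close>, \<open>d\<close>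
  occur in this order on a cycle; together with the two chords it is a subdivision of
  \<open>K_4\<close>.\<close>

definition no_crossing_chords :: "'a set set \<Rightarrow> bool" where
  "no_crossing_chords E \<longleftrightarrow> (\<forall>a b c d A B C D. distinct (a # A @ b # B @ c # C @ d # D) \<longrightarrow>
     ledges (a # A @ b # B @ c # C @ d # D @ [a]) \<subseteq> E \<longrightarrow> {a, c} \<in> E \<longrightarrow> {b, d} \<notin> E)"

lemma no_theta_subset: "no_theta E \<Longrightarrow> F \<subseteq> E \<Longrightarrow> no_theta F"
  unfolding no_theta_def by (meson order_trans)

lemma no_crossing_chords_subset: "no_crossing_chords E \<Longrightarrow> F \<subseteq> E \<Longrightarrow> no_crossing_chords F"
  unfolding no_crossing_chords_def by (meson order_trans subsetD)

section \<open>Ears, Hamiltonian blocks and gluing of vertex orders\<close>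

text \<open>A single edge \<open>[a, b]\<close> counts as a cycle, so every edge can be grown into a longest one.\<close>

definition cycle :: "'a set set \<Rightarrow> 'a list \<Rightarrow> bool" where
  "cycle E xs \<longleftrightarrow> 2 \<le> length xs \<and> distinct xs \<and> ledges (xs @ [hd xs]) \<subseteq> E"

lemma cycle_rotate:
  assumes "cycle E (xs @ a # ys)"
  shows "cycle E (a # ys @ xs)"
proof (cases xs)
  case Nil then show ?thesis using assms by simp
next
  case (Cons x xs')
  have "ledges (xs @ a # ys @ [x]) = ledges (xs @ [a]) \<union> ledges (a # ys @ [x])"
    by (rule ledges_append)
  moreover have "ledges ((a # ys) @ x # xs' @ [a]) = ledges ((a # ys) @ [x]) \<union> ledges (x # xs' @ [a])"
    by (rule ledges_append)
  ultimately show ?thesis using assms Cons unfolding cycle_def by auto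
qed

text \<open>The ends of the ear \<open>P\<close> cut the cycle into two arcs. If one arc has no
  inner vertex, the ear replaces it and the cycle grows; otherwise the ear and the two arcs form a
  theta.\<close>

lemma cycle_ear:
  assumes cyc: "cycle E xs" and ab: "a \<in> set xs" "b \<in> set xs" "a \<noteq> b"
    and P: "P \<noteq> []" "distinct P" "set P \<inter> set xs = {}" "ledges (a # P @ [b]) \<subseteq> E"
    and nt: "no_theta E"
  shows "\<exists>ys. cycle E ys \<and> length xs < length ys"
proof -
  obtain us vs where "xs = us @ a # vs" using ab(1) by (metis split_list)
  then obtain zs where cyc': "cycle E (a # zs)" and zs: "set (a # zs) = set xs" "length (a # zs) = length xs"
    using cycle_rotate cyc by (metis (no_types, lifting) append.assoc append_Cons length_append
        length_Cons set_append list.simps(15) Un_commute Un_insert_right add.commute add_Suc_right)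
  then obtain B1 B2 where B: "zs = B1 @ b # B2" using ab by (metis set_ConsD split_list)
  have dist: "distinct (a # B1 @ b # B2)" using cyc' B unfolding cycle_def by simp
  have disj: "set P \<inter> set (a # B1 @ b # B2) = {}" using P(3) zs(1) B by simp
  have "ledges ((a # B1) @ b # B2 @ [a]) = ledges ((a # B1) @ [b]) \<union> ledges (b # B2 @ [a])"
    by (rule ledges_append)
  then have l1: "ledges (a # B1 @ [b]) \<subseteq> E" and l2: "ledges (b # B2 @ [a]) \<subseteq> E"
    using cyc' B unfolding cycle_def by auto
  have l2': "ledges (a # rev B2 @ [b]) \<subseteq> E" using l2 ledges_rev[of "b # B2 @ [a]"] by simp
  have lP': "ledges (b # rev P @ [a]) \<subseteq> E" using P(4) ledges_rev[of "a # P @ [b]"] by simp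
  show ?thesis
  proof (cases "B1 = []")
    case True
    have "ledges ((a # P) @ b # B2 @ [a]) = ledges ((a # P) @ [b]) \<union> ledges (b # B2 @ [a])"
      by (rule ledges_append)
    then have "cycle E (a # P @ b # B2)"
      using P l2 dist disj unfolding cycle_def by auto
    moreover have "length xs < length (a # P @ b # B2)" using zs(2)[symmetric] B True P(1) by (cases P) auto
    ultimately show ?thesis by blast
  next
    case B1: False
    show ?thesis
    proof (cases "B2 = []")
      case True
      have "ledges ((a # B1) @ b # rev P @ [a]) = ledges ((a # B1) @ [b]) \<union> ledges (b # rev P @ [a])"
        by (rule ledges_append)
      then have "cycle E (a # B1 @ b # rev P)"
        using P lP' l1 dist disj unfolding cycle_def by auto
      moreover have "length xs < length (a # B1 @ b # rev P)" using zs(2)[symmetric] B True P(1) by (cases P) auto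
      ultimately show ?thesis by blast
    next
      case False
      have "distinct (a # b # P @ B1 @ rev B2)" using dist disj P(2) by auto
      then have False
        using nt P l1 l2' B1 False unfolding no_theta_def by (metis Un_least rev_is_Nil_conv)
      then show ?thesis ..
    qed
  qed
qed

text \<open>This covers both a cut vertex \<open>r\<close> and a disconnected graph, whose two sides
  share no vertex.\<close>

definition separable :: "'a set \<Rightarrow> 'a set set \<Rightarrow> bool" where
  "separable V E \<longleftrightarrow> (\<exists>V1 V2 r. V1 \<union> V2 = V \<and> V1 \<noteq> V \<and> V2 \<noteq> V \<and> V1 \<inter> V2 \<subseteq> {r} \<and>
     (\<forall>e\<in>E. e \<subseteq> V1 \<or> e \<subseteq> V2))"

lemma separableI:
  assumes G: "finite_simple_graph V E" and "V1 \<union> V2 = V" "V1 \<noteq> V" "V2 \<noteq> V" "V1 \<inter> V2 \<subseteq> {r}"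
    and cross: "\<And>u w. {u, w} \<in> E \<Longrightarrow> u \<in> V1 - V2 \<Longrightarrow> w \<in> V2 - V1 \<Longrightarrow> False"
  shows "separable V E"
proof -
  have "e \<subseteq> V1 \<or> e \<subseteq> V2" if e: "e \<in> E" for e
  proof -
    have "card e = 2" using G e unfolding finite_simple_graph_def by blast
    then obtain u w where uw: "e = {u, w}" by (meson card_2_iff)
    have "{w, u} \<in> E" "{u, w} \<in> E" using e uw by (auto simp: insert_commute)
    moreover have "u \<in> V1 \<union> V2" "w \<in> V1 \<union> V2"
      using edge_cases[OF G] assms(2) \<open>{u, w} \<in> E\<close> by blast+
    ultimately show ?thesis using cross[of u w] cross[of w u] unfolding uw by blast
  qed
  then show ?thesis using assms unfolding separable_def by blast
qed

text \<open>Leave \<open>C\<close> along an edge from \<open>a\<close> and explore the outside of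
  \<open>C\<close> from there. If no explored vertex had a neighbour in \<open>C\<close> other than
  \<open>a\<close>, then \<open>a\<close> would separate the explored part from the rest.\<close>

lemma nonseparable_ear:
  assumes G: "finite_simple_graph V E" and ns: "\<not> separable V E"
    and C: "C \<subseteq> V" "C \<noteq> V" "x \<in> C" "y \<in> C" "x \<noteq> y"
  obtains a b P where "a \<in> C" "b \<in> C" "a \<noteq> b" "P \<noteq> []" "distinct P" "set P \<inter> C = {}"
    "ledges (a # P @ [b]) \<subseteq> E"
proof -
  have "\<exists>a v. {a, v} \<in> E \<and> a \<in> C \<and> v \<in> V - C"
  proof (rule ccontr)
    assume "\<not> ?thesis"
    then have "separable V E"
      by (intro separableI[OF G, of C "V - C" x]) (use C in auto)
    then show False using ns by blast
  qed
  then obtain a v where av: "{a, v} \<in> E" "a \<in> C" "v \<in> V" "v \<notin> C" by blast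
  \<comment> \<open>Reachability is recorded by duplicate-free walks outside \<open>C\<close>, so
    that a witness of membership is itself the ear.\<close>
  define R where "R = {u. \<exists>P. P \<noteq> [] \<and> hd P = v \<and> last P = u \<and> distinct P \<and> set P \<inter> C = {} \<and> ledges P \<subseteq> E}"
  have vR: "v \<in> R" unfolding R_def using av by (intro CollectI exI[of _ "[v]"]) simp
  have RC: "R \<inter> C = {}" unfolding R_def using last_in_set by blast
  have RV: "R \<subseteq> V"
  proof
    fix u assume "u \<in> R"
    then obtain P where P: "P \<noteq> []" "hd P = v" "last P = u" "ledges P \<subseteq> E" unfolding R_def by blast
    show "u \<in> V"
    proof (cases "u = v")
      case False
      then obtain Q where Q: "P = Q @ [u]" "Q \<noteq> []"
        using P by (metis append_butlast_last_id hd_append2 list.sel(1) append_Nil)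
      then have "{last Q, u} \<in> ledges P" using ledges_snoc[OF Q(2)] by simp
      then show ?thesis using P(4) edge_cases(2)[OF G] by blast
    qed (use av in blast)
  qed
  have step: "w \<in> R" if u: "u \<in> R" and uw: "{u, w} \<in> E" "w \<notin> C" for u w
  proof -
    obtain P where P: "P \<noteq> []" "hd P = v" "last P = u" "distinct P" "set P \<inter> C = {}" "ledges P \<subseteq> E"
      using u unfolding R_def by blast
    show ?thesis
    proof (cases "w \<in> set P")
      case True
      then obtain P1 P2 where "P = P1 @ w # P2" by (metis split_list)
      then show ?thesis unfolding R_def
        using P ledges_append[of P1 w P2]
        by (intro CollectI exI[of _ "P1 @ [w]"]) (auto simp: hd_append)
    next
      case False
      have "ledges (P @ [w]) = insert {u, w} (ledges P)" using ledges_snoc[OF P(1)] P(3) by simp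
      then show ?thesis unfolding R_def
        using P False uw by (intro CollectI exI[of _ "P @ [w]"]) auto
    qed
  qed
  have "\<exists>u\<in>R. \<exists>b\<in>C. b \<noteq> a \<and> {u, b} \<in> E"
  proof (rule ccontr)
    assume no: "\<not> ?thesis"
    have "R \<union> {a} \<noteq> V" using C RC av by blast
    moreover have "V - R \<noteq> V" using vR av by blast
    ultimately have "separable V E"
    proof (intro separableI[OF G, of "R \<union> {a}" "V - R" a])
      fix u w assume "{u, w} \<in> E" "u \<in> R \<union> {a} - (V - R)" "w \<in> V - R - (R \<union> {a})"
      then show False using no step[of u w] av C by blast
    qed (use RV C av RC in auto)
    then show False using ns by blast
  qed
  then obtain u b where b: "u \<in> R" "b \<in> C" "b \<noteq> a" "{u, b} \<in> E" by blast
  then obtain P where P: "P \<noteq> []" "hd P = v" "last P = u" "distinct P" "set P \<inter> C = {}" "ledges P \<subseteq> E"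
    unfolding R_def by blast
  have "ledges (P @ [b]) = insert {u, b} (ledges P)" using ledges_snoc[OF P(1)] P(3) by simp
  moreover obtain P' where P': "P = v # P'" using P(1,2) by (cases P) auto
  ultimately have "ledges (a # P @ [b]) \<subseteq> E" using P(6) b(4) av(1) by auto
  then show ?thesis using that[OF av(2) b(2) b(3)[symmetric] P(1) P(4) P(5)] by blast
qed

lemma cycle_subset:
  assumes "finite_simple_graph V E" "cycle E xs"
  shows "set xs \<subseteq> V"
proof -
  have "set ys \<subseteq> \<Union> (ledges (ys @ [z]))" for z and ys :: "'a list"
    by (induction ys rule: ledges.induct) auto
  then have "set xs \<subseteq> \<Union> (ledges (xs @ [hd xs]))" by blast
  then show ?thesis using assms unfolding cycle_def finite_simple_graph_def by blast
qed

text \<open>A longest cycle that misses a vertex would have an ear, and \<open>cycle_ear\<close>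
  would lengthen it. Existence of a cycle comes from a single edge.\<close>

lemma nonseparable_hamiltonian:
  assumes G: "finite_simple_graph V E" and ns: "\<not> separable V E" and nt: "no_theta E"
    and V2: "2 \<le> card V"
  shows "\<exists>xs. cycle E xs \<and> set xs = V"
proof -
  have finV: "finite V" using G unfolding finite_simple_graph_def by blast
  obtain v where v: "v \<in> V" using V2 by fastforce
  have "\<exists>w. {v, w} \<in> E"
  proof (rule ccontr)
    assume no: "\<not> ?thesis"
    have "separable V E"
    proof (rule separableI[OF G, of "{v}" "V - {v}" v])
      show "{v} \<noteq> V" using V2 by auto
      show "{v} \<union> (V - {v}) = V" "V - {v} \<noteq> V" "{v} \<inter> (V - {v}) \<subseteq> {v}" using v by blast+
      fix u w assume "{u, w} \<in> E" "u \<in> {v} - (V - {v})"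
      then show False using no by blast
    qed
    then show False using ns by blast
  qed
  then obtain w where w: "{v, w} \<in> E" by blast
  then have "cycle E [v, w]" using edge_cases[OF G w] unfolding cycle_def by (simp add: insert_commute)
  moreover have bound: "length xs \<le> card V" if "cycle E xs" for xs
    using card_mono[OF finV cycle_subset[OF G that]] that distinct_card[of xs] unfolding cycle_def by simp
  ultimately have "\<exists>xs. cycle E xs \<and> (\<forall>ys. cycle E ys \<longrightarrow> length ys \<le> length xs)"
    by (intro ex_has_greatest_nat[where b = "Suc (card V)"]) (auto simp: less_Suc_eq_le)
  then obtain xs where xs: "cycle E xs" "\<And>ys. cycle E ys \<Longrightarrow> length ys \<le> length xs" by blast
  have "set xs = V"
  proof (rule ccontr)
    assume ne: "set xs \<noteq> V"
    obtain x y zs where "xs = x # y # zs"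
      using xs(1) unfolding cycle_def by (cases xs rule: ledges.cases) auto
    then have "x \<in> set xs" "y \<in> set xs" "x \<noteq> y" using xs(1) unfolding cycle_def by auto
    then obtain a b P where "a \<in> set xs" "b \<in> set xs" "a \<noteq> b" "P \<noteq> []" "distinct P"
      "set P \<inter> set xs = {}" "ledges (a # P @ [b]) \<subseteq> E"
      using nonseparable_ear[OF G ns cycle_subset[OF G xs(1)] ne] by blast
    then show False using cycle_ear[OF xs(1) _ _ _ _ _ _ _ nt, of a b P] xs(2) by (meson leD)
  qed
  then show ?thesis using xs(1) by blast
qed

text \<open>Positions are read off the Hamiltonian cycle: two interleaving edges would be crossing
  chords of it.\<close>

lemma hamiltonian_noncrossing:
  assumes G: "finite_simple_graph V E" and ncc: "no_crossing_chords E"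
    and xs: "cycle E xs" "set xs = V"
  shows "\<exists>pos. inj_on pos V \<and> noncrossing pos E"
proof -
  define ind where "ind = the_inv_into {..<length xs} ((!) xs)"
  have dist: "distinct xs" using xs(1) unfolding cycle_def by blast
  then have injn: "inj_on ((!) xs) {..<length xs}" by (simp add: inj_on_nth)
  have ind: "ind v < length xs \<and> xs ! ind v = v" if "v \<in> V" for v
  proof -
    have "v \<in> (!) xs ` {..<length xs}" using that xs(2) by (auto simp: in_set_conv_nth)
    then show ?thesis
      unfolding ind_def using f_the_inv_into_f[OF injn] the_inv_into_into[OF injn, of v "{..<length xs}"] by simp
  qed
  have split: "\<exists>P Q. ys = P @ ys ! i # Q \<and> length P = i" if "i < length ys" for ys :: "'a list" and i
    using id_take_nth_drop[OF that] that by (metis length_take min.absorb4)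
  have "noncrossing (\<lambda>v. int (ind v)) E"
    unfolding noncrossing_def
  proof (intro allI impI notI)
    fix a b c d assume e: "{a, c} \<in> E" "{b, d} \<in> E"
      and lt: "int (ind a) < int (ind b)" "int (ind b) < int (ind c)" "int (ind c) < int (ind d)"
    have V: "a \<in> V" "b \<in> V" "c \<in> V" "d \<in> V" using edge_cases[OF G] e by blast+
    \<comment> \<open>The list is cut at \<open>d\<close>, \<open>c\<close>, \<open>b\<close>,
      \<open>a\<close> in turn; the piece before \<open>a\<close> is then rotated to the
      end.\<close>
    obtain P3 Q3 where 3: "xs = P3 @ d # Q3" "length P3 = ind d" using split[of "ind d" xs] ind[OF V(4)] by auto
    have "P3 ! ind c = c" using ind[OF V(3)] 3 lt by (simp add: nth_append)
    then obtain P2 Q2 where 2: "P3 = P2 @ c # Q2" "length P2 = ind c" using split[of "ind c" P3] 3 lt by auto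
    have "P2 ! ind b = b" using ind[OF V(2)] 3 2 lt by (simp add: nth_append)
    then obtain P1 Q1 where 1: "P2 = P1 @ b # Q1" "length P1 = ind b" using split[of "ind b" P2] 2 lt by auto
    have "P1 ! ind a = a" using ind[OF V(1)] 3 2 1 lt by (simp add: nth_append)
    then obtain P0 Q0 where 0: "P1 = P0 @ a # Q0" "length P0 = ind a" using split[of "ind a" P1] 1 lt by auto
    have "cycle E (P0 @ a # (Q0 @ b # Q1 @ c # Q2 @ d # Q3))" using xs(1) 0 1 2 3 by simp
    then have "cycle E (a # (Q0 @ b # Q1 @ c # Q2 @ d # Q3) @ P0)" by (rule cycle_rotate)
    then have "distinct (a # Q0 @ b # Q1 @ c # Q2 @ d # (Q3 @ P0))"
      "ledges (a # Q0 @ b # Q1 @ c # Q2 @ d # (Q3 @ P0) @ [a]) \<subseteq> E"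
      unfolding cycle_def by simp_all
    then show False using ncc e unfolding no_crossing_chords_def by blast
  qed
  moreover have "inj_on (\<lambda>v. int (ind v)) V" by (rule inj_onI) (metis ind of_nat_eq_iff)
  ultimately show ?thesis by blast
qed

text \<open>Interleaving depends only on the cyclic order, so the vertices before \<open>r\<close>
  may be moved behind all others. Having \<open>r\<close> first prepares the gluing.\<close>

lemma noncrossing_rotate:
  assumes G: "finite_simple_graph V E" and inj: "inj_on pos V" and nc: "noncrossing pos E"
  shows "\<exists>pos'. inj_on pos' V \<and> noncrossing pos' E \<and> (\<forall>v\<in>V. pos' r \<le> pos' v)"
proof -
  have finV: "finite (insert r V)" using G unfolding finite_simple_graph_def by blast
  define M where "M = 1 + Max ((\<lambda>(u, v). pos u - pos v) ` (insert r V \<times> insert r V))"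
  have M: "pos u - pos v < M" if "u \<in> insert r V" "v \<in> insert r V" for u v
  proof -
    have "pos u - pos v \<le> Max ((\<lambda>(u, v). pos u - pos v) ` (insert r V \<times> insert r V))"
      by (rule Max_ge) (use that finV in auto)
    then show ?thesis unfolding M_def by simp
  qed
  define pos' where "pos' v = (if pos v < pos r then pos v + M else pos v)" for v
  have "inj_on pos' V"
  proof (rule inj_onI)
    fix u v assume uv: "u \<in> V" "v \<in> V" "pos' u = pos' v"
    then have "pos u = pos v" using M[of u v] M[of v u] unfolding pos'_def by (auto split: if_splits)
    then show "u = v" using inj_onD[OF inj] uv by blast
  qed
  moreover have "noncrossing pos' E"
    unfolding noncrossing_def
  proof (intro allI impI notI)
    fix a b c d assume e: "{a, c} \<in> E" "{b, d} \<in> E" and lt: "pos' a < pos' b" "pos' b < pos' c" "pos' c < pos' d"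
    have V: "a \<in> V" "b \<in> V" "c \<in> V" "d \<in> V" using edge_cases[OF G] e by blast+
    have e': "{c, a} \<in> E" "{d, b} \<in> E" using e by (simp_all add: insert_commute)
    \<comment> \<open>At most one of the three increasing steps wraps around from the end to the
      front of the old order, so \<open>a\<close>, \<open>b\<close>, \<open>c\<close>,
      \<open>d\<close> is a rotation of an interleaving quadruple there.\<close>
    have mono: "pos u < pos v \<and> (pos u < pos r \<longleftrightarrow> pos v < pos r) \<or> pos v < pos r \<and> pos r \<le> pos u"
      if "pos' u < pos' v" "u \<in> V" "v \<in> V" for u v
      using that M[of v u] M[of u v] unfolding pos'_def by (auto split: if_splits)
    show False
      using mono[OF lt(1) V(1,2)] mono[OF lt(2) V(2,3)] mono[OF lt(3) V(3,4)]
        noncrossingD[OF nc e] noncrossingD[OF nc e'(2) e(1)] noncrossingD[OF nc e'(1) e'(2)]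
        noncrossingD[OF nc e(2) e'(1)]
      by linarith
  qed
  moreover have "pos' r \<le> pos' v" if "v \<in> V" for v
    using M[of r v] that unfolding pos'_def by simp
  ultimately show ?thesis by blast
qed

text \<open>With \<open>r\<close> first in both orders, the rest of \<open>V2\<close> is appended
  after \<open>V1\<close>. An edge of \<open>E2\<close> then lies wholly behind \<open>V1\<close> or
  starts at the leftmost vertex \<open>r\<close>, so it crosses no edge of
  \<open>E1\<close>.\<close>

lemma noncrossing_glue:
  assumes G1: "finite_simple_graph V1 E1" and G2: "finite_simple_graph V2 E2" and r: "V1 \<inter> V2 \<subseteq> {r}"
    and pos1: "inj_on pos1 V1" "noncrossing pos1 E1" and pos2: "inj_on pos2 V2" "noncrossing pos2 E2"
  shows "\<exists>pos. inj_on pos (V1 \<union> V2) \<and> noncrossing pos (E1 \<union> E2)"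
proof -
  obtain p where p: "inj_on p V1" "noncrossing p E1" "\<And>v. v \<in> V1 \<Longrightarrow> p r \<le> p v"
    using noncrossing_rotate[OF G1 pos1] by blast
  obtain q where q: "inj_on q V2" "noncrossing q E2" "\<And>v. v \<in> V2 \<Longrightarrow> q r \<le> q v"
    using noncrossing_rotate[OF G2 pos2] by blast
  have fin: "finite (V1 \<times> V2)" using G1 G2 unfolding finite_simple_graph_def by blast
  define M where "M = 1 + Max (insert 0 ((\<lambda>(u, v). p u - q v) ` (V1 \<times> V2)))"
  have M: "p u < q v + M" if "u \<in> V1" "v \<in> V2" for u v
  proof -
    have "p u - q v \<le> Max (insert 0 ((\<lambda>(u, v). p u - q v) ` (V1 \<times> V2)))"
      by (rule Max_ge) (use that fin in auto)
    then show ?thesis unfolding M_def by simp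
  qed
  define pos where "pos v = (if v \<in> V1 then p v else q v + M)" for v
  have F1: "pos u < pos v \<Longrightarrow> p u < p v" if "u \<in> V1" "v \<in> V1" for u v using that unfolding pos_def by simp
  have F3: "pos u < pos v" if "u \<in> V1" "v \<in> V2 - V1" for u v using that M[of u v] unfolding pos_def by simp
  have F4: "\<not> pos u < pos v" if "v \<in> V1 \<inter> V2" "u \<in> V1 \<union> V2" for u v
  proof -
    have "v = r" using that(1) r by blast
    then show ?thesis using that p(3)[of u] M[of v u] unfolding pos_def by auto
  qed
  \<comment> \<open>The shared vertex keeps its place from \<open>p\<close>, but it is first in
    \<open>q\<close> as well, so \<open>pos\<close> still orders \<open>V2\<close> as
    \<open>q\<close> does.\<close>
  have F2: "q u < q v" if "pos u < pos v" "u \<in> V2" "v \<in> V2" for u v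
  proof (cases "u \<in> V1")
    case True
    then have "u = r" using that r by blast
    moreover have "u \<noteq> v" using that(1) by blast
    ultimately show ?thesis using q(3)[OF that(3)] inj_onD[OF q(1) _ that(2,3)] by fastforce
  next
    case False
    then have "v \<notin> V1" using that F4[of v u] by blast
    then show ?thesis using False that unfolding pos_def by simp
  qed
  have "inj_on pos (V1 \<union> V2)"
  proof (rule inj_onI)
    fix u v assume uv: "u \<in> V1 \<union> V2" "v \<in> V1 \<union> V2" "pos u = pos v"
    have "u \<in> V1 \<longleftrightarrow> v \<in> V1" using uv F3[of u v] F3[of v u] by auto
    then show "u = v"
      using uv inj_onD[OF p(1), of u v] inj_onD[OF q(1), of u v] unfolding pos_def by (cases "u \<in> V1") auto
  qed
  moreover have "noncrossing pos (E1 \<union> E2)"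
    unfolding noncrossing_def
  proof (intro allI impI notI)
    fix a b c d assume e: "{a, c} \<in> E1 \<union> E2" "{b, d} \<in> E1 \<union> E2"
      and lt: "pos a < pos b" "pos b < pos c" "pos c < pos d"
    consider (11) "{a, c} \<in> E1" "{b, d} \<in> E1" | (22) "{a, c} \<in> E2" "{b, d} \<in> E2"
      | (12) "{a, c} \<in> E1" "{b, d} \<in> E2" | (21) "{a, c} \<in> E2" "{b, d} \<in> E1" using e by blast
    then show False
    proof cases
      case 11
      then have "a \<in> V1" "b \<in> V1" "c \<in> V1" "d \<in> V1" using edge_cases[OF G1] by blast+
      then show False using noncrossingD[OF p(2) 11] F1 lt by blast
    next
      case 22
      then have "a \<in> V2" "b \<in> V2" "c \<in> V2" "d \<in> V2" using edge_cases[OF G2] by blast+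
      then show False using noncrossingD[OF q(2) 22] F2 lt by blast
    next
      case 12
      then have "a \<in> V1" "c \<in> V1" "b \<in> V2" using edge_cases[OF G1] edge_cases[OF G2] by blast+
      then show False using F4[of b a] F3[of c b] lt by force
    next
      case 21
      then have "c \<in> V2" "b \<in> V1" "d \<in> V1" using edge_cases[OF G1] edge_cases[OF G2] by blast+
      then show False using F4[of c b] F3[of d c] lt by force
    qed
  qed
  ultimately show ?thesis by blast
qed

text \<open>Induction on the number of vertices: a separable graph is split and glued, and a
  nonseparable one is Hamiltonian or has at most one vertex.\<close>

lemma no_theta_no_crossing_chords_noncrossing:
  assumes "finite_simple_graph V E" "no_theta E" "no_crossing_chords E"
  shows "\<exists>pos. inj_on pos V \<and> noncrossing pos E"
  using assms
proof (induction "card V" arbitrary: V E rule: less_induct)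
  case less
  note G = less.prems(1)
  have finV: "finite V" using G unfolding finite_simple_graph_def by blast
  show ?case
  proof (cases "separable V E")
    case True
    then obtain V1 V2 r where s: "V1 \<union> V2 = V" "V1 \<noteq> V" "V2 \<noteq> V" "V1 \<inter> V2 \<subseteq> {r}"
      "\<forall>e\<in>E. e \<subseteq> V1 \<or> e \<subseteq> V2" unfolding separable_def by (elim exE conjE)
    have IH: "\<exists>pos. inj_on pos W \<and> noncrossing pos {e \<in> E. e \<subseteq> W}" if "W \<subset> V" for W
    proof (rule less.hyps)
      show "card W < card V" using psubset_card_mono[OF finV that] .
      show "finite_simple_graph W {e \<in> E. e \<subseteq> W}" using finite_simple_graph_induced[OF G] that by blast
      show "no_theta {e \<in> E. e \<subseteq> W}" by (rule no_theta_subset[OF less.prems(2)]) simp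
      show "no_crossing_chords {e \<in> E. e \<subseteq> W}" by (rule no_crossing_chords_subset[OF less.prems(3)]) simp
    qed
    have sub: "V1 \<subset> V" "V2 \<subset> V" using s by blast+
    obtain pos1 pos2 where
      "inj_on pos1 V1" "noncrossing pos1 {e \<in> E. e \<subseteq> V1}" "inj_on pos2 V2" "noncrossing pos2 {e \<in> E. e \<subseteq> V2}"
      using IH[OF sub(1)] IH[OF sub(2)] by blast
    then have "\<exists>pos. inj_on pos (V1 \<union> V2) \<and> noncrossing pos ({e \<in> E. e \<subseteq> V1} \<union> {e \<in> E. e \<subseteq> V2})"
      using sub by (intro noncrossing_glue[OF finite_simple_graph_induced[OF G] finite_simple_graph_induced[OF G] s(4)]) auto
    moreover have "{e \<in> E. e \<subseteq> V1} \<union> {e \<in> E. e \<subseteq> V2} = E" using s(5) by blast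
    ultimately show ?thesis using s(1) by simp
  next
    case ns: False
    show ?thesis
    proof (cases "2 \<le> card V")
      case True
      then show ?thesis
        using nonseparable_hamiltonian[OF G ns less.prems(2)] hamiltonian_noncrossing[OF G less.prems(3)] by blast
    next
      case False
      then have single: "u = v" if "u \<in> V" "v \<in> V" for u v
        using that card_le_Suc0_iff_eq[OF finV] by auto
      then have "noncrossing (\<lambda>_. 0) E" unfolding noncrossing_def by simp
      moreover have "inj_on (\<lambda>_. 0 :: int) V" using single by (simp add: inj_on_def)
      ultimately show ?thesis by blast
    qed
  qed
qed

subsection \<open>Theta curves and outerplanar drawings\<close>

lemma Jordan_two_arcs:
  fixes c d :: "real \<Rightarrow> complex"
  assumes "arc c" "arc d" "pathstart c = a" "pathfinish c = b" "pathstart d = a" "pathfinish d = b"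
    and "path_image c \<inter> path_image d = {a, b}"
  shows "inside (path_image c \<union> path_image d) \<noteq> {}"
    and "connected (inside (path_image c \<union> path_image d))"
    and "connected (outside (path_image c \<union> path_image d))"
    and "frontier (inside (path_image c \<union> path_image d)) = path_image c \<union> path_image d"
proof -
  let ?g = "c +++ reversepath d"
  have img: "path_image ?g = path_image c \<union> path_image d"
    using assms by (simp add: path_image_join)
  have "simple_path ?g"
    by (rule simple_path_join_loop) (use assms in \<open>auto simp: arc_reversepath\<close>)
  then show "inside (path_image c \<union> path_image d) \<noteq> {}"
    "connected (inside (path_image c \<union> path_image d))"
    "connected (outside (path_image c \<union> path_image d))"
    "frontier (inside (path_image c \<union> path_image d)) = path_image c \<union> path_image d"
    using Jordan_inside_outside[of ?g] assms unfolding img by simp_all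
qed

text \<open>Each region avoids the boundary of the other, so by connectedness intersecting regions
  coincide. Their frontiers then agree too, and the inner points of \<open>d\<close> would lie on
  \<open>c\<close> or \<open>e\<close>.\<close>

lemma theta_faces_disjoint:
  fixes c d e :: "real \<Rightarrow> complex"
  assumes c: "arc c" "pathstart c = a" "pathfinish c = b"
    and d: "arc d" "pathstart d = a" "pathfinish d = b"
    and e: "arc e" "pathstart e = a" "pathfinish e = b"
    and cd: "path_image c \<inter> path_image d = {a, b}" and ce: "path_image c \<inter> path_image e = {a, b}"
    and de: "path_image d \<inter> path_image e = {a, b}"
    and no: "path_image e \<inter> inside (path_image c \<union> path_image d) = {}"
      "path_image d \<inter> inside (path_image c \<union> path_image e) = {}"
  shows "inside (path_image c \<union> path_image d) \<inter> inside (path_image c \<union> path_image e) = {}"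
proof (rule ccontr)
  let ?U = "inside (path_image c \<union> path_image d)" and ?W = "inside (path_image c \<union> path_image e)"
  assume meet: "?U \<inter> ?W \<noteq> {}"
  note U = Jordan_two_arcs[OF c(1) d(1) c(2,3) d(2,3) cd]
  note W = Jordan_two_arcs[OF c(1) e(1) c(2,3) e(2,3) ce]
  have "?U \<inter> (path_image c \<union> path_image d) = {}" "?W \<inter> (path_image c \<union> path_image e) = {}"
    by (simp_all add: inside_no_overlap)
  then have "?U \<inter> frontier ?W = {}" "?W \<inter> frontier ?U = {}" using no unfolding U(4) W(4) by blast+
  then have "?U - ?W = {}" "?W - ?U = {}"
    using connected_Int_frontier[OF U(2) meet] connected_Int_frontier[OF W(2), of ?U] meet
    by (metis, metis Int_commute)
  then have "?U = ?W" by blast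
  then have "frontier ?U = frontier ?W" by (rule arg_cong)
  then have "path_image c \<union> path_image d = path_image c \<union> path_image e" unfolding U(4) W(4) .
  then have "path_image d - {pathstart d, pathfinish d} = {}" using d cd de by blast
  then show False
    using simple_path_endless[OF arc_imp_simple_path[OF d(1)]] by (simp add: greaterThanLessThan_empty_iff2)
qed

text \<open>
  If no arc enters the bounded region cut off by the other two, then a point of one of these
  regions can be joined to infinity while avoiding either pair of arcs containing the third one;
  these two pairs meet in a connected set, so by Janiszewski all three arcs can be avoided at once.
\<close>

lemma theta_arc_inside:
  fixes c1 c2 c3 :: "real \<Rightarrow> complex"
  assumes c1: "arc c1" "pathstart c1 = a" "pathfinish c1 = b"
    and c2: "arc c2" "pathstart c2 = a" "pathfinish c2 = b"
    and c3: "arc c3" "pathstart c3 = a" "pathfinish c3 = b"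
    and i12: "path_image c1 \<inter> path_image c2 = {a, b}" and i13: "path_image c1 \<inter> path_image c3 = {a, b}"
    and i23: "path_image c2 \<inter> path_image c3 = {a, b}"
  shows "path_image c1 \<inter> inside (path_image c2 \<union> path_image c3) \<noteq> {} \<or>
    path_image c2 \<inter> inside (path_image c1 \<union> path_image c3) \<noteq> {} \<or>
    path_image c3 \<inter> inside (path_image c1 \<union> path_image c2) \<noteq> {}"
proof (rule ccontr)
  let ?c1 = "path_image c1" and ?c2 = "path_image c2" and ?c3 = "path_image c3"
  assume "\<not> ?thesis"
  then have no: "?c1 \<inter> inside (?c2 \<union> ?c3) = {}" "?c2 \<inter> inside (?c1 \<union> ?c3) = {}" "?c3 \<inter> inside (?c1 \<union> ?c2) = {}"
    by blast+
  have cpt: "compact ?c1" "compact ?c2" "compact ?c3" using c1 c2 c3 by (simp_all add: compact_arc_image)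
  obtain u where u: "u \<in> inside (?c1 \<union> ?c2)"
    using Jordan_two_arcs(1)[OF c1(1) c2(1) c1(2,3) c2(2,3) i12] by blast
  have "u \<notin> inside (?c1 \<union> ?c3)"
    using theta_faces_disjoint[OF c1 c2 c3 i12 i13 i23 no(3,2)] u by blast
  moreover have "u \<notin> inside (?c2 \<union> ?c3)"
  proof -
    have "?c2 \<inter> ?c1 = {a, b}" "?c3 \<inter> inside (?c2 \<union> ?c1) = {}" using i12 no(3) by (simp_all add: Un_commute Int_commute)
    then show ?thesis using theta_faces_disjoint[OF c2 c1 c3 _ i23 i13 _ no(1)] u by (auto simp: Un_commute)
  qed
  moreover have "u \<notin> ?c1 \<union> ?c2 \<union> ?c3"
    using u no(3) inside_no_overlap[of "?c1 \<union> ?c2"] by blast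
  ultimately have uout: "u \<in> outside (?c1 \<union> ?c3)" "u \<in> outside (?c2 \<union> ?c3)"
    using inside_Un_outside[of "?c1 \<union> ?c3"] inside_Un_outside[of "?c2 \<union> ?c3"] by blast+
  have "bounded (?c1 \<union> ?c2 \<union> ?c3)" using cpt by (simp add: compact_imp_bounded)
  \<comment> \<open>The point \<open>w\<close> plays the role of infinity.\<close>
  then obtain w where w: "w \<in> outside (?c1 \<union> ?c2 \<union> ?c3)" using outside_bounded_nonempty by blast
  then have wout: "w \<in> outside (?c1 \<union> ?c3)" "w \<in> outside (?c2 \<union> ?c3)" "w \<in> outside (?c1 \<union> ?c2)"
    by (meson outside_mono subsetD Un_mono Un_upper1 Un_upper2 order_refl Un_least le_supI1)+
  have "connected_component (- (?c1 \<union> ?c3)) u w"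
    unfolding connected_component_def
    using Jordan_two_arcs(3)[OF c1(1) c3(1) c1(2,3) c3(2,3) i13] uout(1) wout(1)
      outside_no_overlap[of "?c1 \<union> ?c3"] by (intro exI[of _ "outside (?c1 \<union> ?c3)"]) blast
  moreover have "connected_component (- (?c2 \<union> ?c3)) u w"
    unfolding connected_component_def
    using Jordan_two_arcs(3)[OF c2(1) c3(1) c2(2,3) c3(2,3) i23] uout(2) wout(2)
      outside_no_overlap[of "?c2 \<union> ?c3"] by (intro exI[of _ "outside (?c2 \<union> ?c3)"]) blast
  moreover have "(?c1 \<union> ?c3) \<inter> (?c2 \<union> ?c3) = ?c3" using i12 i13 by blast
  then have "connected ((?c1 \<union> ?c3) \<inter> (?c2 \<union> ?c3))" using c3 by (simp add: connected_arc_image)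
  moreover have "compact (?c1 \<union> ?c3)" "closed (?c2 \<union> ?c3)"
    using cpt by (simp_all add: compact_Un compact_imp_closed closed_Un)
  ultimately have "connected_component (- ((?c1 \<union> ?c3) \<union> (?c2 \<union> ?c3))) u w"
    by (intro Janiszewski[of "?c1 \<union> ?c3" "?c2 \<union> ?c3"])
  then have "connected_component (- (?c1 \<union> ?c2)) u w"
    using connected_component_mono[of "- ((?c1 \<union> ?c3) \<union> (?c2 \<union> ?c3))" "- (?c1 \<union> ?c2)"] by blast
  then have "w \<in> inside (?c1 \<union> ?c2)" using u inside_same_component by blast
  then show False using wout(3) inside_Int_outside by blast
qed

text \<open>By continuity at 0 and 1, the ends of an arc are limits of its inner points.\<close>

lemma arc_endpoints_closure:
  fixes c :: "real \<Rightarrow> complex"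
  assumes "arc c"
  shows "path_image c \<subseteq> closure (path_image c - {pathstart c, pathfinish c})"
proof -
  have "c ` closure {0<..<1} \<subseteq> closure (c ` {0<..<1})"
    by (rule image_closure_subset)
      (use assms in \<open>auto simp: arc_def path_def closure_greaterThanLessThan intro: closure_subset[THEN subsetD]\<close>)
  then show ?thesis
    using simple_path_endless[OF arc_imp_simple_path[OF assms]] by (simp add: path_image_def)
qed

section \<open>Walks in an outerplanar drawing\<close>

locale outer_embedding =
  fixes V :: "'a set" and E :: "'a set set" and p :: "'a \<Rightarrow> complex" and \<gamma> :: "'a set \<Rightarrow> real \<Rightarrow> complex"
  assumes G: "finite_simple_graph V E" and emb: "plane_embedding V E p \<gamma>"
    and outer: "p ` V \<subseteq> frontier (outside (drawing V E p \<gamma>))"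
begin

definition curve :: "'a list \<Rightarrow> complex set" where
  "curve xs = (\<Union>e\<in>ledges xs. path_image (\<gamma> e))"

text \<open>Enlarging a set shrinks its outside, so \<open>p v\<close> lies in the closure of
  \<open>outside K\<close>, which the open set \<open>inside K\<close> cannot meet. This is where
  the outer-face condition enters.\<close>

lemma vertex_not_inside:
  assumes "closed K" "K \<subseteq> drawing V E p \<gamma>" "v \<in> V"
  shows "p v \<notin> inside K"
proof
  assume "p v \<in> inside K"
  moreover have "p v \<in> closure (outside K)"
    using outer assms(3) closure_mono[OF outside_mono[OF assms(2)]] unfolding frontier_def by blast
  ultimately have "inside K \<inter> outside K \<noteq> {}"
    using open_inside[OF assms(1)] open_Int_closure_eq_empty by blast
  then show False by simp
qed

lemma edge_arc: "e \<in> E \<Longrightarrow> arc (\<gamma> e)"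
  and edge_ends: "e \<in> E \<Longrightarrow> {pathstart (\<gamma> e), pathfinish (\<gamma> e)} = p ` e"
  and edge_vertices: "e \<in> E \<Longrightarrow> path_image (\<gamma> e) \<inter> p ` V = p ` e"
  and edge_Int: "e \<in> E \<Longrightarrow> f \<in> E \<Longrightarrow> e \<noteq> f \<Longrightarrow> path_image (\<gamma> e) \<inter> path_image (\<gamma> f) = p ` (e \<inter> f)"
  and p_eq: "u \<in> V \<Longrightarrow> v \<in> V \<Longrightarrow> p u = p v \<longleftrightarrow> u = v"
  using emb unfolding plane_embedding_def by (auto dest: inj_onD)

lemma curve_subset_drawing: "ledges xs \<subseteq> E \<Longrightarrow> curve xs \<subseteq> drawing V E p \<gamma>"
  unfolding curve_def drawing_def by blast

lemma closed_curve: "ledges xs \<subseteq> E \<Longrightarrow> closed (curve xs)"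
proof (induction xs rule: ledges.induct)
  case (1 x y zs)
  then have "closed (path_image (\<gamma> {x, y}))" using closed_arc_image[OF edge_arc] by simp
  then show ?case using 1 unfolding curve_def by (simp add: closed_Un)
qed (simp_all add: curve_def)

lemma vertex_in_curve:
  assumes "ledges xs \<subseteq> E" "2 \<le> length xs" "v \<in> set xs"
  shows "p v \<in> curve xs"
  using assms
proof (induction xs rule: ledges.induct)
  case (1 x y zs)
  have e: "{x, y} \<in> E" using 1 by simp
  have xy: "p x \<in> path_image (\<gamma> {x, y})" "p y \<in> path_image (\<gamma> {x, y})" using edge_vertices[OF e] by blast+
  show ?case
  proof (cases "v \<in> {x, y}")
    case True then show ?thesis using xy unfolding curve_def by auto
  next
    case False
    then have "v \<in> set zs" using 1 by simp
    then have "p v \<in> curve (y # zs)" using 1 by (cases zs) auto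
    then show ?thesis unfolding curve_def by simp
  qed
qed auto

lemma curve_vertexD:
  assumes "ledges xs \<subseteq> E" "v \<in> V" "p v \<in> curve xs"
  shows "v \<in> set xs"
proof -
  obtain e where e: "e \<in> ledges xs" "p v \<in> path_image (\<gamma> e)" using assms(3) unfolding curve_def by blast
  then have "e \<in> E" using assms by blast
  then have "p v \<in> p ` e" "e \<subseteq> V"
    using edge_vertices e assms(2) G unfolding finite_simple_graph_def by blast+
  then have "v \<in> e" using p_eq assms(2) by blast
  then show ?thesis using ledges_subset[OF e(1)] by blast
qed

lemma curve_Int:
  assumes "ledges xs \<subseteq> E" "ledges ys \<subseteq> E" "ledges xs \<inter> ledges ys = {}"
  shows "curve xs \<inter> curve ys \<subseteq> p ` (set xs \<inter> set ys)"
proof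
  fix z assume "z \<in> curve xs \<inter> curve ys"
  then obtain e f where ef: "e \<in> ledges xs" "f \<in> ledges ys" "z \<in> path_image (\<gamma> e) \<inter> path_image (\<gamma> f)"
    unfolding curve_def by blast
  then have "z \<in> p ` (e \<inter> f)" using edge_Int[of e f] assms by blast
  then show "z \<in> p ` (set xs \<inter> set ys)" using ledges_subset[OF ef(1)] ledges_subset[OF ef(2)] by blast
qed

text \<open>\<open>\<gamma>\<close> is indexed by unordered edges, so an edge may have to be
  traversed backwards.\<close>

lemma edge_oriented:
  assumes "{x, y} \<in> E"
  obtains g where "arc g" "pathstart g = p x" "pathfinish g = p y" "path_image g = path_image (\<gamma> {x, y})"
proof (cases "pathstart (\<gamma> {x, y}) = p x")
  case True
  moreover have "pathfinish (\<gamma> {x, y}) = p y"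
    using edge_ends[OF assms] True arc_distinct_ends[OF edge_arc[OF assms]] by (auto simp: doubleton_eq_iff)
  ultimately show ?thesis using that[of "\<gamma> {x, y}"] edge_arc[OF assms] by simp
next
  case False
  then have "pathstart (\<gamma> {x, y}) = p y" "pathfinish (\<gamma> {x, y}) = p x"
    using edge_ends[OF assms] by (auto simp: doubleton_eq_iff)
  then show ?thesis using that[of "reversepath (\<gamma> {x, y})"] edge_arc[OF assms] by (simp add: arc_reversepath)
qed

text \<open>As the vertices are distinct, the first edge meets the curve of the remaining walk only
  at their common vertex, so the join is again an arc.\<close>

lemma walk_arc:
  assumes "distinct xs" "ledges xs \<subseteq> E" "2 \<le> length xs"
  shows "\<exists>g. arc g \<and> pathstart g = p (hd xs) \<and> pathfinish g = p (last xs) \<and> path_image g = curve xs"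
  using assms
proof (induction xs rule: ledges.induct)
  case (1 x y zs)
  have e: "{x, y} \<in> E" using 1 by simp
  obtain h where h: "arc h" "pathstart h = p x" "pathfinish h = p y" "path_image h = path_image (\<gamma> {x, y})"
    using edge_oriented[OF e] by blast
  have h': "path_image h = curve [x, y]" unfolding curve_def using h by simp
  show ?case
  proof (cases "zs = []")
    case True then show ?thesis using h h' by auto
  next
    case False
    then obtain g where g: "arc g" "pathstart g = p y" "pathfinish g = p (last (y # zs))" "path_image g = curve (y # zs)"
      using 1 by (cases zs) auto
    have "{x, y} \<notin> ledges (y # zs)" using ledges_subset 1(2) by fastforce
    then have "ledges [x, y] \<inter> ledges (y # zs) = {}" by simp
    then have "curve [x, y] \<inter> curve (y # zs) \<subseteq> p ` (set [x, y] \<inter> set (y # zs))"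
      using 1(3) by (intro curve_Int) auto
    then have "path_image h \<inter> path_image g \<subseteq> {pathstart g}" using 1(2) unfolding h' g by auto
    then have "arc (h +++ g)" using h g by (intro arc_join) auto
    moreover have "path_image (h +++ g) = curve (x # y # zs)"
      using h g by (subst path_image_join) (auto simp: curve_def)
    ultimately show ?thesis using h g by (intro exI[of _ "h +++ g"]) simp
  qed
qed auto

text \<open>A common edge could only be \<open>{a, b}\<close>, which the walk through
  \<open>P\<close> does not use, so the curves meet only in common vertices. The list
  \<open>Q\<close> may be empty, which admits a chord.\<close>

lemma parallel_walks_Int:
  assumes dist: "distinct (a # b # P @ Q)" and "P \<noteq> []"
    and E: "ledges (a # P @ [b]) \<subseteq> E" "ledges (a # Q @ [b]) \<subseteq> E"
  shows "curve (a # P @ [b]) \<inter> curve (a # Q @ [b]) = {p a, p b}"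
proof
  have "{a, b} \<notin> ledges (a # P @ [b])"
  proof
    assume ab: "{a, b} \<in> ledges (a # P @ [b])"
    obtain x P' where P: "P = x # P'" using assms(2) by (cases P) auto
    then consider "{a, b} = {a, x}" | "{a, b} \<in> ledges (x # P' @ [b])" using ab by auto
    then show False
    proof cases
      case 1 then show False using dist P by (auto simp: doubleton_eq_iff)
    next
      case 2 then show False using ledges_subset[OF 2] dist P by auto
    qed
  qed
  moreover have "e = {a, b}" if "e \<in> ledges (a # P @ [b])" "e \<in> ledges (a # Q @ [b])" for e
  proof -
    have "e \<subseteq> {a, b}" using ledges_subset[OF that(1)] ledges_subset[OF that(2)] dist by auto
    moreover have "card e = 2" using that(1) E(1) G unfolding finite_simple_graph_def by blast
    ultimately show ?thesis using dist by (intro card_subset_eq) auto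
  qed
  ultimately have "ledges (a # P @ [b]) \<inter> ledges (a # Q @ [b]) = {}" by blast
  then have "curve (a # P @ [b]) \<inter> curve (a # Q @ [b]) \<subseteq> p ` (set (a # P @ [b]) \<inter> set (a # Q @ [b]))"
    by (rule curve_Int[OF E])
  moreover have "set (a # P @ [b]) \<inter> set (a # Q @ [b]) = {a, b}" using dist by auto
  ultimately show "curve (a # P @ [b]) \<inter> curve (a # Q @ [b]) \<subseteq> {p a, p b}" by (metis image_insert image_empty)
  show "{p a, p b} \<subseteq> curve (a # P @ [b]) \<inter> curve (a # Q @ [b])"
    using vertex_in_curve[OF E(1)] vertex_in_curve[OF E(2)] by simp
qed

lemma inner_vertex:
  assumes dist: "distinct (a # b # P)" and P: "P \<noteq> []" and E: "ledges (a # P @ [b]) \<subseteq> E"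
  shows "\<exists>v\<in>set P. v \<in> V \<and> p v \<in> curve (a # P @ [b]) - {p a, p b}"
proof -
  obtain v P' where v: "P = v # P'" using P by (cases P) auto
  then have e: "{a, v} \<in> E" using E by simp
  have sub: "\<Union> (ledges (a # P @ [b])) \<subseteq> V" using E G unfolding finite_simple_graph_def by blast
  have "b \<in> \<Union> (ledges (a # P @ [b]))"
    using ledges_snoc[of "a # P" b] by simp
  then have "b \<in> V" using sub by blast
  moreover have "a \<in> V" "v \<in> V" using edge_cases[OF G e] by blast+
  moreover have "p v \<in> curve (a # P @ [b])" using vertex_in_curve[OF E] v by simp
  ultimately show ?thesis using p_eq dist v by (intro bexI[of _ v]) auto
qed

text \<open>
  Neither of the two paths through inner vertices can be the one enclosed by the other two,
  since no vertex is enclosed by a closed curve of the drawing.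
\<close>

lemma theta_split:
  assumes dist: "distinct (a # b # P @ Q @ R)" and ne: "P \<noteq> []" "Q \<noteq> []"
    and E: "ledges (a # P @ [b]) \<subseteq> E" "ledges (a # Q @ [b]) \<subseteq> E" "ledges (a # R @ [b]) \<subseteq> E"
  defines "p1 \<equiv> curve (a # P @ [b])" and "p2 \<equiv> curve (a # Q @ [b])" and "p3 \<equiv> curve (a # R @ [b])"
  shows "inside (p1 \<union> p3) \<inter> inside (p2 \<union> p3) = {}"
    and "inside (p1 \<union> p3) \<union> inside (p2 \<union> p3) \<union> (p3 - {p a, p b}) = inside (p1 \<union> p2)"
proof -
  have dists: "distinct (a # P @ [b])" "distinct (a # Q @ [b])" "distinct (a # R @ [b])" using dist by auto
  obtain c1 where c1: "arc c1" "pathstart c1 = p a" "pathfinish c1 = p b" "path_image c1 = p1"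
    using walk_arc[OF dists(1) E(1)] unfolding p1_def by auto
  obtain c2 where c2: "arc c2" "pathstart c2 = p a" "pathfinish c2 = p b" "path_image c2 = p2"
    using walk_arc[OF dists(2) E(2)] unfolding p2_def by auto
  obtain c3 where c3: "arc c3" "pathstart c3 = p a" "pathfinish c3 = p b" "path_image c3 = p3"
    using walk_arc[OF dists(3) E(3)] unfolding p3_def by auto
  have i12: "p1 \<inter> p2 = {p a, p b}" unfolding p1_def p2_def
    by (rule parallel_walks_Int) (use dist ne E in auto)
  have i13: "p1 \<inter> p3 = {p a, p b}" unfolding p1_def p3_def
    by (rule parallel_walks_Int) (use dist ne E in auto)
  have i23: "p2 \<inter> p3 = {p a, p b}" unfolding p2_def p3_def
    by (rule parallel_walks_Int) (use dist ne E in auto)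
  have i21: "p2 \<inter> p1 = {p a, p b}" and i31: "p3 \<inter> p1 = {p a, p b}" and i32: "p3 \<inter> p2 = {p a, p b}"
    using i12 i13 i23 by blast+
  have ab: "p a \<noteq> p b" using arc_distinct_ends[OF c1(1)] c1 by simp
  have sp: "simple_path c1" "simple_path c2" "simple_path c3" using c1 c2 c3 by (simp_all add: arc_imp_simple_path)
  have ni: "p v \<notin> inside (p1 \<union> p3)" "p v \<notin> inside (p2 \<union> p3)" if "v \<in> V" for v
    using vertex_not_inside[OF _ _ that] closed_curve[OF E(1)] closed_curve[OF E(2)] closed_curve[OF E(3)]
      curve_subset_drawing[OF E(1)] curve_subset_drawing[OF E(2)] curve_subset_drawing[OF E(3)]
    unfolding p1_def p2_def p3_def by (simp_all add: closed_Un)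
  \<comment> \<open>If \<open>p1\<close> had a point in that region, all of it except its ends would
    lie there, including an inner vertex.\<close>
  have "p1 \<inter> inside (p2 \<union> p3) = {}"
  proof (rule ccontr)
    assume "p1 \<inter> inside (p2 \<union> p3) \<noteq> {}"
    then have "p1 - {p a, p b} \<subseteq> inside (p2 \<union> p3)"
      using split_inside_simple_closed_curve[OF sp(2) c2(2,3) sp(3) c3(2,3) sp(1) c1(2,3) ab]
        i23 i21 i31 unfolding c1(4) c2(4) c3(4) by blast
    moreover obtain v where "v \<in> V" "p v \<in> p1 - {p a, p b}"
      using inner_vertex[of a b P] dist ne E unfolding p1_def by auto
    ultimately show False using ni(2) by blast
  qed
  moreover have "p2 \<inter> inside (p1 \<union> p3) = {}"
  proof (rule ccontr)
    assume "p2 \<inter> inside (p1 \<union> p3) \<noteq> {}"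
    then have "p2 - {p a, p b} \<subseteq> inside (p1 \<union> p3)"
      using split_inside_simple_closed_curve[OF sp(1) c1(2,3) sp(3) c3(2,3) sp(2) c2(2,3) ab]
        i13 i12 i32 unfolding c1(4) c2(4) c3(4) by blast
    moreover obtain v where "v \<in> V" "p v \<in> p2 - {p a, p b}"
      using inner_vertex[of a b Q] dist ne E unfolding p2_def by auto
    ultimately show False using ni(1) by blast
  qed
  ultimately have "p3 \<inter> inside (p1 \<union> p2) \<noteq> {}"
    using theta_arc_inside[OF c1(1-3) c2(1-3) c3(1-3)] i12 i13 i23 unfolding c1(4) c2(4) c3(4) by blast
  then show "inside (p1 \<union> p3) \<inter> inside (p2 \<union> p3) = {}"
    "inside (p1 \<union> p3) \<union> inside (p2 \<union> p3) \<union> (p3 - {p a, p b}) = inside (p1 \<union> p2)"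
    using split_inside_simple_closed_curve[OF sp(1) c1(2,3) sp(2) c2(2,3) sp(3) c3(2,3) ab]
      i12 i13 i23 unfolding c1(4) c2(4) c3(4) by blast+
qed

text \<open>The third path has an inner vertex too, and by \<open>theta_split\<close> the other two
  would enclose it.\<close>

lemma no_theta: "no_theta E"
  unfolding no_theta_def
proof (intro allI impI notI)
  fix a b P Q R
  assume ne: "P \<noteq> []" "Q \<noteq> []" "R \<noteq> []" and dist: "distinct (a # b # P @ Q @ R)"
    and "ledges (a # P @ [b]) \<union> ledges (a # Q @ [b]) \<union> ledges (a # R @ [b]) \<subseteq> E"
  then have E: "ledges (a # P @ [b]) \<subseteq> E" "ledges (a # Q @ [b]) \<subseteq> E" "ledges (a # R @ [b]) \<subseteq> E" by blast+
  obtain v where v: "v \<in> V" "p v \<in> curve (a # R @ [b]) - {p a, p b}"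
    using inner_vertex[of a b R] dist ne E by auto
  then have "p v \<in> inside (curve (a # P @ [b]) \<union> curve (a # Q @ [b]))"
    using theta_split(2)[OF dist ne(1,2) E] by blast
  then show False
    using vertex_not_inside[OF _ _ v(1)] closed_curve[OF E(1)] closed_curve[OF E(2)]
      curve_subset_drawing[OF E(1)] curve_subset_drawing[OF E(2)] by (simp add: closed_Un)
qed

text \<open>Both chords run inside the cycle, so \<open>{a, c}\<close> splits its interior into a
  side bordering \<open>b\<close> and a side bordering \<open>d\<close>. The inner part of
  \<open>{b, d}\<close> is connected and stays on one side, yet both \<open>p b\<close> and
  \<open>p d\<close> are limits of it.\<close>

lemma no_crossing_chords: "no_crossing_chords E"
  unfolding no_crossing_chords_def
proof (intro allI impI notI)
  fix a b c d A B C D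
  assume dist: "distinct (a # A @ b # B @ c # C @ d # D)"
    and cyc: "ledges (a # A @ b # B @ c # C @ d # D @ [a]) \<subseteq> E"
    and ac: "{a, c} \<in> E" and bd: "{b, d} \<in> E"
  have V: "a \<in> V" "b \<in> V" "c \<in> V" "d \<in> V" using edge_cases[OF G] ac bd by blast+
  have "ledges (a # A @ b # B @ c # C @ d # D @ [a]) =
      ledges (a # A @ [b]) \<union> (ledges (b # B @ [c]) \<union> (ledges (c # C @ [d]) \<union> ledges (d # D @ [a])))"
    using ledges_append[of "a # A" b "B @ c # C @ d # D @ [a]"] ledges_append[of "b # B" c "C @ d # D @ [a]"]
      ledges_append[of "c # C" d "D @ [a]"] by simp
  then have S: "ledges (a # A @ [b]) \<subseteq> E" "ledges (b # B @ [c]) \<subseteq> E" "ledges (c # C @ [d]) \<subseteq> E"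
    "ledges (d # D @ [a]) \<subseteq> E" using cyc by blast+
  \<comment> \<open>\<open>?P\<close> and \<open>?Q\<close> are the two halves of the cycle from
    \<open>a\<close> to \<open>c\<close>, \<open>?P'\<close> and \<open>?Q'\<close> those from
    \<open>b\<close> to \<open>d\<close>; the second half of each pair runs against the cycle, hence
    \<open>rev\<close>.\<close>
  let ?P = "A @ b # B" and ?Q = "rev (C @ d # D)" and ?P' = "B @ c # C" and ?Q' = "rev (D @ a # A)"
  have rev1: "a # ?Q @ [c] = rev (c # C @ d # D @ [a])" and rev2: "b # ?Q' @ [d] = rev (d # D @ a # A @ [b])"
    by simp_all
  have L: "ledges (a # ?P @ [c]) = ledges (a # A @ [b]) \<union> ledges (b # B @ [c])"
    "ledges (b # ?P' @ [d]) = ledges (b # B @ [c]) \<union> ledges (c # C @ [d])"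
    "ledges (a # ?Q @ [c]) = ledges (c # C @ [d]) \<union> ledges (d # D @ [a])"
    "ledges (b # ?Q' @ [d]) = ledges (d # D @ [a]) \<union> ledges (a # A @ [b])"
    unfolding rev1 rev2 ledges_rev
    using ledges_append[of "a # A" b "B @ [c]"] ledges_append[of "b # B" c "C @ [d]"]
      ledges_append[of "c # C" d "D @ [a]"] ledges_append[of "d # D" a "A @ [b]"] by simp_all
  have LE: "ledges (a # ?P @ [c]) \<subseteq> E" "ledges (b # ?P' @ [d]) \<subseteq> E"
    "ledges (a # ?Q @ [c]) \<subseteq> E" "ledges (b # ?Q' @ [d]) \<subseteq> E"
    unfolding L using S by blast+
  let ?ac = "curve [a, c]"
  let ?I1 = "inside (curve (a # ?P @ [c]) \<union> ?ac)" and ?I2 = "inside (curve (a # ?Q @ [c]) \<union> ?ac)"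
  \<comment> \<open>Both pairs of halves make up the same closed curve, so
    \<open>theta_split\<close> places both chords in the same interior.\<close>
  have Z: "curve (a # ?P @ [c]) \<union> curve (a # ?Q @ [c]) = curve (b # ?P' @ [d]) \<union> curve (b # ?Q' @ [d])"
    unfolding curve_def L by blast
  have ac': "ledges [a, c] \<subseteq> E" and bd': "ledges [b, d] \<subseteq> E" using ac bd by simp_all
  have ne: "?P \<noteq> []" "?Q \<noteq> []" "?P' \<noteq> []" "?Q' \<noteq> []" by simp_all
  have "distinct (a # c # ?P @ ?Q @ [])" using dist by auto
  note s1 = theta_split[OF this ne(1,2) LE(1,3), unfolded append_Nil, OF ac']
  have "distinct (b # d # ?P' @ ?Q' @ [])" using dist by auto
  note s2 = theta_split(2)[OF this ne(3,4) LE(2,4), unfolded append_Nil, OF bd']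
  have nac: "{a, c} \<noteq> {b, d}" "{a, c} \<inter> {b, d} = {}" using dist by (auto simp: doubleton_eq_iff)
  have "curve [b, d] \<inter> curve [a, c] = {}"
    unfolding curve_def using edge_Int[OF bd ac] nac by (simp add: Int_commute)
  moreover have "curve [b, d] - {p b, p d} \<subseteq> inside (curve (a # ?P @ [c]) \<union> curve (a # ?Q @ [c]))"
    unfolding Z using s2 by blast
  ultimately have sub: "curve [b, d] - {p b, p d} \<subseteq> ?I1 \<union> ?I2" using s1(2) by blast
  have bdimg: "curve [b, d] = path_image (\<gamma> {b, d})" unfolding curve_def by simp
  have ends: "{pathstart (\<gamma> {b, d}), pathfinish (\<gamma> {b, d})} = {p b, p d}" using edge_ends[OF bd] by simp
  have conn: "connected (curve [b, d] - {p b, p d})"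
    using connected_simple_path_endless[OF arc_imp_simple_path[OF edge_arc[OF bd]]] unfolding bdimg ends .
  have clo: "p b \<in> closure (curve [b, d] - {p b, p d})" "p d \<in> closure (curve [b, d] - {p b, p d})"
    using arc_endpoints_closure[OF edge_arc[OF bd]] ends edge_vertices[OF bd] unfolding bdimg by auto
  have closed: "closed (curve (a # ?P @ [c]) \<union> ?ac)" "closed (curve (a # ?Q @ [c]) \<union> ?ac)"
    using closed_curve[OF LE(1)] closed_curve[OF LE(3)] closed_curve[OF ac'] by (simp_all only: closed_Un)
  have "?I1 \<inter> ?I2 = {}" by (rule s1(1))
  then have "curve [b, d] - {p b, p d} \<subseteq> ?I1 \<or> curve [b, d] - {p b, p d} \<subseteq> ?I2"
    using connectedD[OF conn open_inside[OF closed(1)] open_inside[OF closed(2)]] sub by blast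
  \<comment> \<open>The end to look at is the one that is not on the boundary of the side containing
    the inner part of \<open>{b, d}\<close>.\<close>
  then consider "p d \<in> closure ?I1" | "p b \<in> closure ?I2" using clo closure_mono by blast
  then show False
  proof cases
    case 1
    have "p d \<notin> ?I1"
      by (rule vertex_not_inside[OF closed(1) _ V(4)])
        (use curve_subset_drawing[OF LE(1)] curve_subset_drawing[OF ac'] in blast)
    then have "p d \<in> curve (a # ?P @ [c]) \<or> p d \<in> ?ac" using 1 closure_inside_subset[OF closed(1)] by blast
    then have "d \<in> set (a # ?P @ [c]) \<or> d \<in> set [a, c]"
      using curve_vertexD[OF LE(1) V(4)] curve_vertexD[OF ac' V(4)] by blast
    then show False using dist by auto
  next
    case 2
    have "p b \<notin> ?I2"
      by (rule vertex_not_inside[OF closed(2) _ V(2)])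
        (use curve_subset_drawing[OF LE(3)] curve_subset_drawing[OF ac'] in blast)
    then have "p b \<in> curve (a # ?Q @ [c]) \<or> p b \<in> ?ac" using 2 closure_inside_subset[OF closed(2)] by blast
    then have "b \<in> set (a # ?Q @ [c]) \<or> b \<in> set [a, c]"
      using curve_vertexD[OF LE(3) V(2)] curve_vertexD[OF ac' V(2)] by blast
    then show False using dist by auto
  qed
qed

end

subsection \<open>The dimension bound\<close>

theorem theorem5:
  fixes V :: "'a set" and E :: "'a set set"
  assumes "finite_simple_graph V E"
    and "outerplanar V E"
  shows "poset_dim (adjacency_carrier V) (adjacency_order V E) \<le> 4"
proof -
  obtain p \<gamma> where "plane_embedding V E p \<gamma>" "p ` V \<subseteq> frontier (outside (drawing V E p \<gamma>))"
    using assms(2) unfolding outerplanar_def by blast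
  then interpret outer_embedding V E p \<gamma>
    using assms(1) by unfold_locales
  obtain pos where "inj_on pos V" "noncrossing pos E"
    using no_theta_no_crossing_chords_noncrossing[OF assms(1) no_theta no_crossing_chords] by blast
  then show ?thesis
    by (rule noncrossing_poset_dim_le_4[OF assms(1)])
qed

end
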